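(* Let $d\ge1$. There is a constant $C_d>0$ depending only on $d$ such that the following holds. Let $F:\mathbb R^n\to\mathbb R$ be a multilinear polynomial of degree $d$, and for $0\le m\le d$ let $F_m$ be its degree-$m$ homogeneous component. Let $N\sim\mathcal N(0,\mathrm I_n)$ and suppose: (i) $\mathbb E[F(N)]=0$ and $\mathbb E[F(N)^2]=1$; (ii) for all distinct indices $m,m',m'',m'''\le d$ (each inequality being required for all choices of distinct values of the indices appearing in it), $$\mathbb E[F_m(N)F_{m'}(N)^3]\ge0,\quad \mathbb E[F_m(N)F_{m'}(N)F_{m''}(N)^2]\ge0,\quad \mathbb E[F_m(N)F_{m'}(N)F_{m''}(N)F_{m'''}(N)]\ge0.$$ Then, for $\mathcal Z\sim\mathcal N(0,1)$, $$W_1(F(N),\mathcal Z)\le C_d\cdot\max_{1\le m\le d}\mathbb E[F_m(N)^2]^{-1}\cdot\left(\sqrt{\mathbb E[F(N)^4]-3}+\left(\mathbb E[F(N)^4]-3\right)^{1/4}\right),$$ $$d_2(F(N),\mathcal Z)\le C_d\left(\sqrt{\mathbb E[F(N)^4]-3}+\left(\mathbb E[F(N)^4]-3\right)^{1/4}\right),$$ where $\mathbb E[F_m(N)^2]^{-1}=+\infty$ if $F_m=0$.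
   Context: A multilinear polynomial of degree $d$ is $F(x)=\sum_{I\subset[n],|I|\le d}\alpha_Ix^I$ with $x^I=\prod_{i\in I}x_i$; its degree-$m$ homogeneous component is $F_m(x)=\sum_{|I|=m}\alpha_Ix^I$. For real random variables, $W_1(A,B)=\inf\mathbb E|A-B|$ over all couplings of $A$ and $B$ (the 1-Wasserstein distance), and $d_2(A,B)=\sup|\mathbb E f(A)-\mathbb E f(B)|$ over all twice differentiable $f:\mathbb R\to\mathbb R$ with $\|f'\|_\infty\le1$ and $\|f''\|_\infty\le1$. *)

theory Defs
  imports "HOL-Probability.Probability"
begin

text \<open>
  A family of coefficients \<open>\<alpha>\<close>, indexed by the subsets of \<open>{..<n}\<close>, represents a multilinear
  polynomial in the \<open>n\<close> variables \<open>x 0, \<dots>, x (n - 1)\<close>. Coefficients at other sets are ignored,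
  and \<open>d\<close> is only an upper bound for the degree: top-degree coefficients may vanish.
\<close>

definition multilinear_poly :: "nat \<Rightarrow> nat \<Rightarrow> (nat set \<Rightarrow> real) \<Rightarrow> (nat \<Rightarrow> real) \<Rightarrow> real" where
  "multilinear_poly n d \<alpha> x = (\<Sum>I | I \<subseteq> {..<n} \<and> card I \<le> d. \<alpha> I * (\<Prod>i\<in>I. x i))"

definition hom_component :: "nat \<Rightarrow> (nat set \<Rightarrow> real) \<Rightarrow> nat \<Rightarrow> (nat \<Rightarrow> real) \<Rightarrow> real" where
  "hom_component n \<alpha> m x = (\<Sum>I | I \<subseteq> {..<n} \<and> card I = m. \<alpha> I * (\<Prod>i\<in>I. x i))"

lemma multilinear_poly_eq_sum_hom_component:
  "multilinear_poly n d \<alpha> x = (\<Sum>m\<le>d. hom_component n \<alpha> m x)"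
proof -
  have "{I. I \<subseteq> {..<n} \<and> card I \<le> d} = (\<Union>m\<in>{..d}. {I. I \<subseteq> {..<n} \<and> card I = m})"
    by auto
  moreover have "(\<Sum>I\<in>(\<Union>m\<in>{..d}. {I. I \<subseteq> {..<n} \<and> card I = m}). \<alpha> I * (\<Prod>i\<in>I. x i))
      = (\<Sum>m\<le>d. \<Sum>I | I \<subseteq> {..<n} \<and> card I = m. \<alpha> I * (\<Prod>i\<in>I. x i))"
    by (rule sum.UNION_disjoint) auto
  ultimately show ?thesis
    by (simp add: multilinear_poly_def hom_component_def)
qed

text \<open>
  The standard Gaussian law on \<open>\<real>\<^sup>n\<close>. Vectors are functions on the explicit index set \<open>{..<n}\<close>,
  rather than elements of a type of fixed dimension, so that \<open>n\<close> can be quantified inside a formula.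
\<close>

definition std_gaussian :: "nat \<Rightarrow> (nat \<Rightarrow> real) measure" where
  "std_gaussian n = (\<Pi>\<^sub>M i\<in>{..<n}. std_normal_distribution)"

text \<open>
  A coupling of two laws on \<open>\<real>\<close> is the joint law of a pair of random variables having them as
  marginals; the distances below depend on the random variables only through their laws.
\<close>

definition couplings :: "real measure \<Rightarrow> real measure \<Rightarrow> (real \<times> real) measure set" where
  "couplings \<mu> \<nu> = {\<pi>. prob_space \<pi> \<and> sets \<pi> = sets (borel \<Otimes>\<^sub>M borel)
     \<and> distr \<pi> borel fst = \<mu> \<and> distr \<pi> borel snd = \<nu>}"

definition W1_dist :: "real measure \<Rightarrow> real measure \<Rightarrow> ennreal" where
  "W1_dist \<mu> \<nu> = (INF \<pi>\<in>couplings \<mu> \<nu>. \<integral>\<^sup>+ p. ennreal \<bar>fst p - snd p\<bar> \<partial>\<pi>)"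

text \<open>The second derivative of a test function is bounded by 1 but need not be continuous.\<close>

definition d2_test_functions :: "(real \<Rightarrow> real) set" where
  "d2_test_functions = {f. \<exists>f' f''. \<forall>x.
     (f has_real_derivative f' x) (at x) \<and> (f' has_real_derivative f'' x) (at x)
     \<and> \<bar>f' x\<bar> \<le> 1 \<and> \<bar>f'' x\<bar> \<le> 1}"

text \<open>
  The test functions are Lipschitz, so this is meaningful for laws with a finite first moment;
  otherwise a Bochner integral below may take its default value 0.
\<close>

definition d2_dist :: "real measure \<Rightarrow> real measure \<Rightarrow> ennreal" where
  "d2_dist \<mu> \<nu> = (SUP f\<in>d2_test_functions. ennreal \<bar>(\<integral>x. f x \<partial>\<mu>) - (\<integral>x. f x \<partial>\<nu>)\<bar>)"

end

theory Submission
  imports Defs "HOL-Real_Asymp.Real_Asymp"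
begin

text \<open>
  With the carre du champ \<open>\<Gamma>(u, v) = \<nabla>u \<bullet> \<nabla>v\<close>, Gaussian integration by parts gives
  \<open>E[F f(F)] = E[T f'(F)]\<close> for \<open>T = \<Sum>\<^sub>p\<^sub>,\<^sub>q \<Gamma>(F\<^sub>p, F\<^sub>q) / p\<close>. So Stein's equation for
  Lipschitz test functions, combined with the quantile coupling, yields \<open>W\<^sub>1 \<le> 3 E|T - 1|\<close>. This
  suffices because \<open>d\<^sub>2 \<le> W\<^sub>1\<close> and the maximum in the first bound is at least 1.

  To bound \<open>E[(T - 1)\<^sup>2]\<close>, use that the Ornstein-Uhlenbeck generator \<open>L\<close> satisfies
  \<open>E[((L + D) u)\<^sup>2] \<le> D E[u (L + D) u]\<close> for polynomials \<open>u\<close> of degree at most \<open>D\<close>, and that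
  \<open>(L + p + q)(F\<^sub>p F\<^sub>q) = 2 \<Gamma>(F\<^sub>p, F\<^sub>q)\<close>. This controls the variance of \<open>\<Gamma>(F\<^sub>p, F\<^sub>p)\<close> by the
  fourth cumulant of \<open>F\<^sub>p\<close>, and \<open>E[\<Gamma>(F\<^sub>p, F\<^sub>q)\<^sup>2]\<close> for \<open>p \<noteq> q\<close> by \<open>Cov(F\<^sub>p\<^sup>2, F\<^sub>q\<^sup>2)\<close> and that
  cumulant. Under the sign conditions each of these cumulants and covariances is nonnegative and
  at most \<open>E[F\<^sup>4] - 3\<close>, because \<open>E[F\<^sup>4] - 3\<close> is a sum over \<open>(i, j, k, l)\<close> of the nonnegative
  differences between \<open>E[F\<^sub>i F\<^sub>j F\<^sub>k F\<^sub>l]\<close> and its value for independent Gaussian components.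
\<close>

section \<open>One-dimensional Gaussian integration by parts\<close>

lemma power_times_gauss_tendsto:
  "((\<lambda>x::real. x ^ k * exp (- x\<^sup>2 / 2)) \<longlongrightarrow> 0) at_top"
  "((\<lambda>x::real. x ^ k * exp (- x\<^sup>2 / 2)) \<longlongrightarrow> 0) at_bot"
  by real_asymp+

lemma poly_times_density_tendsto:
  fixes p :: "real poly"
  assumes "F = at_top \<or> F = at_bot"
  shows "((\<lambda>x. poly p x * std_normal_density x) \<longlongrightarrow> 0) F"
proof -
  have "((\<lambda>x. x ^ k * std_normal_density x) \<longlongrightarrow> 0) F" for k
    using assms tendsto_mult_right_zero[OF power_times_gauss_tendsto(1), of "1 / sqrt (2 * pi)" k]
      tendsto_mult_right_zero[OF power_times_gauss_tendsto(2), of "1 / sqrt (2 * pi)" k]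
    unfolding std_normal_density_def by (auto simp: mult_ac)
  then have "((\<lambda>x. \<Sum>i\<le>degree p. coeff p i * (x ^ i * std_normal_density x)) \<longlongrightarrow>
    (\<Sum>i\<le>degree p. coeff p i * 0)) F"
    by (intro tendsto_sum tendsto_mult_left)
  then show ?thesis
    by (simp add: poly_altdef sum_distrib_right mult.assoc)
qed

lemma integrable_poly_gauss: "integrable std_normal_distribution (poly p)"
  unfolding poly_altdef[abs_def]
  by (intro Bochner_Integration.integrable_sum integrable_mult_right
    integrable_std_normal_distribution_moment)

lemma std_normal_density_deriv:
  "(std_normal_density has_real_derivative - x * std_normal_density x) (at x within A)"
  unfolding std_normal_density_def
  by (auto intro!: derivative_eq_intros simp: power2_eq_square field_simps)

text \<open>Integrability of non-polynomial integrands is obtained from polynomial majorants; this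
  bound supplies one for an absolute value.\<close>

lemma abs_le_one_plus_square: "\<bar>t\<bar> \<le> 1 + t\<^sup>2" for t :: real
proof -
  have "0 \<le> (\<bar>t\<bar> - 1)\<^sup>2"
    by simp
  then have "2 * \<bar>t\<bar> \<le> 1 + t\<^sup>2"
    by (simp add: power2_diff)
  then show ?thesis
    by linarith
qed

text \<open>The fundamental theorem of calculus for \<open>g\<close> times the density, whose
  derivative is \<open>h\<close>. The boundary values vanish because \<open>g\<close> is dominated
  by a polynomial. Asking for domination instead of a polynomial \<open>g\<close> is what later
  admits solutions of Stein's equation.\<close>

lemma gauss_ibp:
  fixes g g' :: "real \<Rightarrow> real"
  assumes g: "\<And>t. (g has_real_derivative g' t) (at t)" and cont: "continuous_on UNIV g'"
    and p: "\<And>t. \<bar>g t\<bar> \<le> poly p t" and q: "\<And>t. \<bar>g' t\<bar> \<le> poly q t"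
  shows "(\<integral>t. t * g t \<partial>std_normal_distribution) = (\<integral>t. g' t \<partial>std_normal_distribution)"
proof -
  have gc: "continuous_on UNIV g"
    using g by (meson DERIV_isCont continuous_at_imp_continuous_on)
  have [measurable]: "g \<in> borel_measurable borel" "g' \<in> borel_measurable borel"
    using gc cont by (auto intro: borel_measurable_continuous_onI)
  have i1: "integrable std_normal_distribution g'"
    by (rule Bochner_Integration.integrable_bound[OF integrable_poly_gauss[of q]])
      (use q in \<open>auto intro: order_trans abs_ge_self\<close>)
  have i2: "integrable std_normal_distribution (\<lambda>t. t * g t)"
  proof (rule Bochner_Integration.integrable_bound
      [OF integrable_poly_gauss[of "(1 + [:0,1:]^2) * p"]])
    have "\<bar>t * g t\<bar> \<le> \<bar>(1 + t\<^sup>2) * poly p t\<bar>" for t :: real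
    proof -
      have "\<bar>t\<bar> \<le> 1 + t\<^sup>2"
        by (rule abs_le_one_plus_square)
      then show ?thesis
        unfolding abs_mult by (intro mult_mono) (use p[of t] in auto)
    qed
    then show "AE t in std_normal_distribution. norm (t * g t)
      \<le> norm (poly ((1 + [:0, 1:]\<^sup>2) * p) t)"
      by simp
  qed simp
  define h where "h = (\<lambda>t. (g' t - t * g t) * std_normal_density t)"
  have ih: "integrable lborel h"
    using Bochner_Integration.integrable_diff[OF i1 i2] unfolding h_def
    by (subst (asm) integrable_density) (auto simp: mult_ac)
  have lim: "((\<lambda>t. g t * std_normal_density t) \<longlongrightarrow> 0) F" if "F = at_top \<or> F = at_bot" for F
    by (rule Lim_null_comparison[OF _ poly_times_density_tendsto[OF that, of p]])
      (use p in \<open>auto simp: abs_mult intro!: always_eventually mult_right_mono\<close>)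
  have "(LBINT t=-\<infinity>..\<infinity>. h t) = 0 - 0"
  proof (rule interval_integral_FTC_integrable)
    show "((\<lambda>t. g t * std_normal_density t) has_vector_derivative h t) (at t)" for t
      unfolding has_real_derivative_iff_has_vector_derivative[symmetric] h_def
      by (auto intro!: derivative_eq_intros g std_normal_density_deriv simp: algebra_simps)
    have "continuous_on UNIV std_normal_density"
      using std_normal_density_deriv by (meson DERIV_isCont continuous_at_imp_continuous_on)
    then show "isCont h t" for t
      unfolding h_def using cont gc
      by (auto simp: continuous_on_eq_continuous_at intro!: continuous_intros)
    show "(((\<lambda>t. g t * std_normal_density t) \<circ> real_of_ereal) \<longlongrightarrow> 0) (at_right (- \<infinity>))"
      "(((\<lambda>t. g t * std_normal_density t) \<circ> real_of_ereal) \<longlongrightarrow> 0) (at_left \<infinity>)"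
      unfolding ereal_tendsto_simps by (rule lim; simp)+
  qed (use ih in \<open>auto simp: set_integrable_def\<close>)
  then have "(\<integral>t. h t \<partial>lborel) = 0"
    by (simp add: interval_lebesgue_integral_def set_lebesgue_integral_def)
  then have "(\<integral>t. g' t - t * g t \<partial>std_normal_distribution) = 0"
    unfolding h_def by (subst integral_density) (auto simp: mult_ac)
  then show ?thesis
    using i1 i2 by simp
qed

section \<open>Polynomials in finitely many variables\<close>

text \<open>\<open>D\<close> is only an upper bound for the degree. Products are built one variable
  at a time, so that inductions can follow the exponents; closure under general products is
  \<open>poly_deg_mult\<close>.\<close>

inductive poly_deg :: "nat \<Rightarrow> nat \<Rightarrow> ((nat \<Rightarrow> real) \<Rightarrow> real) \<Rightarrow> bool" for n where
  poly_deg_const: "poly_deg n D (\<lambda>x. c)"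
| poly_deg_var_mult: "i < n \<Longrightarrow> poly_deg n D f \<Longrightarrow> poly_deg n (Suc D) (\<lambda>x. x i * f x)"
| poly_deg_add: "poly_deg n D f \<Longrightarrow> poly_deg n D g \<Longrightarrow> poly_deg n D (\<lambda>x. f x + g x)"

lemma poly_deg_Suc: "poly_deg n D f \<Longrightarrow> poly_deg n (Suc D) f"
  by (induction rule: poly_deg.induct) (auto intro: poly_deg.intros)

lemma poly_deg_mono: "D \<le> D' \<Longrightarrow> poly_deg n D f \<Longrightarrow> poly_deg n D' f"
  by (induction D' rule: dec_induct) (auto intro: poly_deg_Suc)

lemma poly_deg_cmult: "poly_deg n D f \<Longrightarrow> poly_deg n D (\<lambda>x. c * f x)"
proof (induction rule: poly_deg.induct)
  case (poly_deg_var_mult i D f)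
  then have "poly_deg n (Suc D) (\<lambda>x. x i * (c * f x))"
    by (intro poly_deg.intros)
  then show ?case
    by (simp add: mult.left_commute)
qed (auto intro: poly_deg.intros simp: distrib_left)

lemma poly_deg_diff: "poly_deg n D f \<Longrightarrow> poly_deg n D g \<Longrightarrow> poly_deg n D (\<lambda>x. f x - g x)"
  using poly_deg_add[of n D f "\<lambda>x. (-1) * g x"] poly_deg_cmult[of n D g "-1"] by simp

lemma poly_deg_mult: "poly_deg n D f \<Longrightarrow> poly_deg n D' g \<Longrightarrow> poly_deg n (D + D') (\<lambda>x. f x * g x)"
proof (induction rule: poly_deg.induct)
  case (poly_deg_const D c)
  then show ?case
    using poly_deg_mono[of D' "D + D'"] poly_deg_cmult by simp
next
  case (poly_deg_var_mult i D f)
  then have "poly_deg n (Suc (D + D')) (\<lambda>x. x i * (f x * g x))"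
    by (intro poly_deg.intros)
  then show ?case
    by (simp add: mult.assoc)
qed (auto intro: poly_deg.intros simp: distrib_right)

lemma poly_deg_0D: "poly_deg n D f \<Longrightarrow> D = 0 \<Longrightarrow> \<exists>c. f = (\<lambda>x. c)"
  by (induction rule: poly_deg.induct) auto

lemma poly_deg_prod:
  "finite I \<Longrightarrow> I \<subseteq> {..<n} \<Longrightarrow> poly_deg n (card I) (\<lambda>x. \<Prod>i\<in>I. x i)"
  by (induction I rule: finite_induct) (auto intro: poly_deg.intros)

text \<open>Reduces differentiability, continuity and growth along a coordinate line to facts about
  univariate polynomials.\<close>

lemma poly_deg_line:
  "poly_deg n D f \<Longrightarrow> \<exists>p. \<forall>t. f (x(i := t)) = poly p t"
proof (induction rule: poly_deg.induct)
  case (poly_deg_const D c)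
  then show ?case
    by (intro exI[of _ "[:c:]"]) simp
next
  case (poly_deg_var_mult j D f)
  then obtain p where "\<forall>t. f (x(i := t)) = poly p t"
    by blast
  then show ?case
    by (intro exI[of _ "(if j = i then [:0, 1:] else [:x j:]) * p"]) (simp del: fun_upd_apply, simp)
next
  case (poly_deg_add D f g)
  then obtain p q where "\<forall>t. f (x(i := t)) = poly p t" "\<forall>t. g (x(i := t)) = poly q t"
    by blast
  then show ?case
    by (intro exI[of _ "p + q"]) (simp del: fun_upd_apply)
qed

section \<open>Partial derivatives of polynomials\<close>

definition partial :: "nat \<Rightarrow> ((nat \<Rightarrow> real) \<Rightarrow> real) \<Rightarrow> (nat \<Rightarrow> real) \<Rightarrow> real" where
  "partial i f x = deriv (\<lambda>t. f (x(i := t))) (x i)"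

definition poly_fun :: "nat \<Rightarrow> ((nat \<Rightarrow> real) \<Rightarrow> real) \<Rightarrow> bool" where
  "poly_fun n f \<longleftrightarrow> (\<exists>D. poly_deg n D f)"

lemma poly_funI: "poly_deg n D f \<Longrightarrow> poly_fun n f"
  by (auto simp: poly_fun_def)

lemma poly_fun_simps [simp]:
  "poly_fun n (\<lambda>x. c)"
  "i < n \<Longrightarrow> poly_fun n (\<lambda>x. x i)"
  by (auto intro: poly_funI poly_deg_const poly_deg_var_mult[of i n 0 "\<lambda>_. 1", simplified])

lemma poly_fun_add [simp]:
  assumes "poly_fun n f" "poly_fun n g"
  shows "poly_fun n (\<lambda>x. f x + g x)"
proof -
  obtain D D' where "poly_deg n D f" "poly_deg n D' g"
    using assms by (auto simp: poly_fun_def)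
  then have "poly_deg n (max D D') (\<lambda>x. f x + g x)"
    by (intro poly_deg_add) (auto intro: poly_deg_mono[rotated])
  then show ?thesis
    by (rule poly_funI)
qed

lemma poly_fun_mult [simp]: "poly_fun n f \<Longrightarrow> poly_fun n g \<Longrightarrow> poly_fun n (\<lambda>x. f x * g x)"
  by (auto simp: poly_fun_def dest: poly_deg_mult)

lemma poly_fun_minus [simp]: "poly_fun n f \<Longrightarrow> poly_fun n (\<lambda>x. - f x)"
  using poly_fun_mult[of n "\<lambda>x. -1" f] by simp

lemma poly_fun_diff [simp]: "poly_fun n f \<Longrightarrow> poly_fun n g \<Longrightarrow> poly_fun n (\<lambda>x. f x - g x)"
  using poly_fun_add[of n f "\<lambda>x. - g x"] by simp

lemma poly_fun_power [simp]: "poly_fun n f \<Longrightarrow> poly_fun n (\<lambda>x. f x ^ k)"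
  by (induction k) auto

lemma poly_fun_divide [simp]: "poly_fun n f \<Longrightarrow> poly_fun n (\<lambda>x. f x / c)"
  using poly_fun_mult[of n "\<lambda>x. 1 / c" f] by simp

lemma poly_fun_sum [simp]:
  "(\<And>i. i \<in> A \<Longrightarrow> poly_fun n (f i)) \<Longrightarrow> poly_fun n (\<lambda>x. \<Sum>i\<in>A. f i x)"
  by (induction A rule: infinite_finite_induct) auto

lemma partial_eqI:
  "((\<lambda>t. f (x(i := t))) has_real_derivative y) (at (x i)) \<Longrightarrow> partial i f x = y"
  unfolding partial_def by (rule DERIV_imp_deriv)

lemma partial_DERIV:
  assumes "poly_fun n f"
  shows "((\<lambda>t. f (x(i := t))) has_real_derivative partial i f (x(i := s))) (at s)"
proof -
  obtain p where p: "\<And>t. f (x(i := t)) = poly p t"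
    using assms poly_deg_line[of n _ f x i] by (auto simp: poly_fun_def)
  have "((\<lambda>t. f (x(i := t))) has_real_derivative poly (pderiv p) s) (at s)"
    unfolding p by (rule poly_DERIV)
  moreover from this have "partial i f (x(i := s)) = poly (pderiv p) s"
    by (intro partial_eqI) simp
  ultimately show ?thesis
    by simp
qed

lemma partial_DERIV':
  "poly_fun n f \<Longrightarrow> ((\<lambda>t. f (x(i := t))) has_real_derivative partial i f x) (at (x i))"
  using partial_DERIV[of n f x i "x i"] by simp

lemma partial_const [simp]: "partial i (\<lambda>x. c) = (\<lambda>x. 0)"
  by (rule ext, rule partial_eqI) simp

lemma partial_var: "partial i (\<lambda>x. x j) = (\<lambda>x. if i = j then 1 else 0)"
  by (rule ext, rule partial_eqI) auto

lemma partial_add: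
  "poly_fun n f \<Longrightarrow> poly_fun n g \<Longrightarrow>
    partial i (\<lambda>x. f x + g x) = (\<lambda>x. partial i f x + partial i g x)"
  by (rule ext, rule partial_eqI) (auto intro!: derivative_eq_intros partial_DERIV')

lemma partial_diff:
  "poly_fun n f \<Longrightarrow> poly_fun n g \<Longrightarrow>
    partial i (\<lambda>x. f x - g x) = (\<lambda>x. partial i f x - partial i g x)"
  by (rule ext, rule partial_eqI) (auto intro!: derivative_eq_intros partial_DERIV')

lemma partial_mult:
  "poly_fun n f \<Longrightarrow> poly_fun n g \<Longrightarrow>
    partial i (\<lambda>x. f x * g x) = (\<lambda>x. partial i f x * g x + f x * partial i g x)"
  by (rule ext, rule partial_eqI) (auto intro!: derivative_eq_intros partial_DERIV')

lemma partial_cmult: "poly_fun n f \<Longrightarrow> partial i (\<lambda>x. c * f x) = (\<lambda>x. c * partial i f x)"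
  by (simp add: partial_mult[of n])

lemma partial_sum:
  "(\<And>j. j \<in> A \<Longrightarrow> poly_fun n (f j)) \<Longrightarrow>
    partial i (\<lambda>x. \<Sum>j\<in>A. f j x) = (\<lambda>x. \<Sum>j\<in>A. partial i (f j) x)"
  by (induction A rule: infinite_finite_induct) (simp_all add: partial_add[of n])

text \<open>The dichotomy makes the induction work: with a truncated \<open>D - 1\<close> alone, a
  factor \<open>f\<close> of degree 0 would give \<open>x j * partial i f\<close> the degree bound 1
  instead of 0, so the vanishing of its derivative has to be recorded.\<close>

lemma poly_deg_partial_aux:
  "poly_deg n D f \<Longrightarrow> (D = 0 \<and> partial i f = (\<lambda>x. 0)) \<or> (\<exists>E. D = Suc E \<and> poly_deg n E (partial i f))"
proof (induction rule: poly_deg.induct)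
  case (poly_deg_const D c)
  then show ?case
    by (cases D) (auto intro: poly_deg.poly_deg_const)
next
  case (poly_deg_var_mult j D f)
  have eq: "partial i (\<lambda>x. x j * f x) = (\<lambda>x. (if i = j then 1 else 0) * f x + x j * partial i f x)"
    using poly_deg_var_mult poly_funI by (subst partial_mult[of n]) (auto simp: partial_var)
  have "poly_deg n D (\<lambda>x. x j * partial i f x)"
    using poly_deg_var_mult poly_deg.poly_deg_var_mult by (auto intro: poly_deg.poly_deg_const)
  then have "poly_deg n D (partial i (\<lambda>x. x j * f x))"
    unfolding eq by (intro poly_deg_add poly_deg_cmult poly_deg_var_mult)
  then show ?case
    by blast
next
  case (poly_deg_add D f g)
  then have "partial i (\<lambda>x. f x + g x) = (\<lambda>x. partial i f x + partial i g x)"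
    using partial_add poly_funI by blast
  then show ?case
    using poly_deg_add by (auto intro: poly_deg.poly_deg_add)
qed

lemma poly_deg_partial: "poly_deg n D f \<Longrightarrow> poly_deg n (D - 1) (partial i f)"
  using poly_deg_partial_aux[of n D f i] poly_deg_const[of n 0 0] by auto

lemma partial_deg_0: "poly_deg n 0 f \<Longrightarrow> partial i f = (\<lambda>x. 0)"
  using poly_deg_partial_aux[of n 0 f i] by auto

lemma poly_fun_partial [simp]: "poly_fun n f \<Longrightarrow> poly_fun n (partial i f)"
  using poly_deg_partial[of n _ f i] unfolding poly_fun_def by blast

lemma partial_commute: "poly_fun n f \<Longrightarrow> partial i (partial j f) = partial j (partial i f)"
proof -
  have "poly_deg n D f \<Longrightarrow> partial i (partial j f) = partial j (partial i f)" for D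
  proof (induction rule: poly_deg.induct)
    case (poly_deg_var_mult k D f)
    have [simp]: "poly_fun n f" "k < n"
      using poly_deg_var_mult poly_funI by auto
    have 1: "partial a (\<lambda>x. x k * f x)
      = (\<lambda>x. (if a = k then 1 else 0) * f x + x k * partial a f x)" for a
      by (subst partial_mult[of n]) (simp_all add: partial_var)
    have 2: "partial a (partial b (\<lambda>x. x k * f x)) = (\<lambda>x. (if b = k then 1 else 0) * partial a f x
        + ((if a = k then 1 else 0) * partial b f x + x k * partial a (partial b f) x))" for a b
      unfolding 1
      by (simp add: partial_add[of n] partial_mult[of n] partial_cmult[of n] partial_var
          del: if_split)
    show ?case
      unfolding 2 by (simp only: poly_deg_var_mult.IH add_ac)
  next
    case (poly_deg_add D f g)
    have [simp]: "poly_fun n f" "poly_fun n g"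
      using poly_deg_add poly_funI by auto
    show ?case
      by (simp only: partial_add[of n] poly_fun_partial poly_deg_add.IH
          \<open>poly_fun n f\<close> \<open>poly_fun n g\<close>)
  qed simp
  then show "poly_fun n f \<Longrightarrow> ?thesis"
    unfolding poly_fun_def by blast
qed

section \<open>The Ornstein-Uhlenbeck generator\<close>

lemma prob_space_gauss: "prob_space std_normal_distribution"
  using real_dist_normal_dist by (simp add: real_distribution_def)

lemma prob_space_std_gaussian: "prob_space (std_gaussian n)"
  unfolding std_gaussian_def by (intro prob_space_PiM prob_space_gauss)

lemma measurable_poly_fun:
  "poly_fun n f \<Longrightarrow> f \<in> borel_measurable (std_gaussian n)"
proof -
  have "poly_deg n D f \<Longrightarrow> f \<in> borel_measurable (std_gaussian n)" for D
  proof (induction rule: poly_deg.induct)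
    case (poly_deg_var_mult i D f)
    have "(\<lambda>x. x i) \<in> measurable (std_gaussian n) std_normal_distribution"
      using poly_deg_var_mult(1) unfolding std_gaussian_def
      by (intro measurable_component_singleton) simp
    then have "(\<lambda>x. x i) \<in> borel_measurable (std_gaussian n)"
      by (simp cong: measurable_cong_sets)
    then show ?case
      using poly_deg_var_mult by measurable
  qed measurable
  then show "poly_fun n f \<Longrightarrow> ?thesis"
    by (auto simp: poly_fun_def)
qed

lemma integrable_poly_fun [simp]:
  assumes "poly_fun n f"
  shows "integrable (std_gaussian n) f"
proof -
  interpret P: product_sigma_finite "\<lambda>_::nat. std_normal_distribution"
    using prob_space_gauss by (auto simp: product_sigma_finite_def prob_space_imp_sigma_finite)
  \<comment> \<open>An arbitrary monomial factor is carried along: a variable \<open>x i\<close> is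
    then absorbed into the exponents \<open>k\<close>, and the base case is a product of
    one-dimensional moments.\<close>
  have "integrable (std_gaussian n) (\<lambda>x. (\<Prod>i<n. x i ^ k i) * f x)" if "poly_deg n D f" for D k
    using that
  proof (induction arbitrary: k rule: poly_deg.induct)
    case (poly_deg_const D c)
    show ?case
      unfolding std_gaussian_def
      by (intro integrable_mult_left P.product_integrable_prod
        integrable_std_normal_distribution_moment) auto
  next
    case (poly_deg_var_mult i D f)
    have "(\<Prod>j<n. x j ^ k j) * (x i * f x) = (\<Prod>j<n. x j ^ (k(i := Suc (k i))) j) * f x"
      for x :: "nat \<Rightarrow> real"
    proof -
      have "(\<Prod>j<n. x j ^ (k(i := Suc (k i))) j) = (\<Prod>j<n. x j ^ k j * (if j = i then x i else 1))"
        by (intro prod.cong) auto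
      also have "\<dots> = (\<Prod>j<n. x j ^ k j) * x i"
        using poly_deg_var_mult(1) by (simp add: prod.distrib)
      finally show ?thesis
        by simp
    qed
    then show ?case
      using poly_deg_var_mult.IH by presburger
  next
    case (poly_deg_add D f g)
    then show ?case
      by (simp add: distrib_left)
  qed
  from this[of _ "\<lambda>_. 0"] show ?thesis
    using assms by (auto simp: poly_fun_def)
qed

text \<open>Fubini isolates coordinate \<open>i\<close> and \<open>gauss_ibp\<close> treats the
  inner integral. Only growth bounds along lines are imposed, so that \<open>chaos_stein\<close> can
  use a \<open>g\<close> with a non-polynomial factor.\<close>

lemma std_gaussian_ibp:
  assumes i: "i < n"
    and int: "integrable (std_gaussian n) (\<lambda>x. x i * g x)" "integrable (std_gaussian n) g'"
    and deriv: "\<And>x t. ((\<lambda>t. g (x(i := t))) has_real_derivative g' (x(i := t))) (at t)"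
    and cont: "\<And>x. continuous_on UNIV (\<lambda>t. g' (x(i := t)))"
    and bound: "\<And>x. \<exists>p. \<forall>t. \<bar>g (x(i := t))\<bar> \<le> poly p t" "\<And>x. \<exists>p. \<forall>t. \<bar>g' (x(i := t))\<bar> \<le> poly p t"
  shows "(\<integral>x. x i * g x \<partial>std_gaussian n) = (\<integral>x. g' x \<partial>std_gaussian n)"
proof -
  interpret P: product_sigma_finite "\<lambda>_::nat. std_normal_distribution"
    using prob_space_gauss by (auto simp: product_sigma_finite_def prob_space_imp_sigma_finite)
  let ?J = "{..<n} - {i}"
  have J: "std_gaussian n = PiM (insert i ?J) (\<lambda>_. std_normal_distribution)"
    using i by (simp add: std_gaussian_def insert_absorb)
  have "(\<integral>x. x i * g x \<partial>std_gaussian n)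
    = (\<integral>x. (\<integral>t. t * g (x(i := t)) \<partial>std_normal_distribution) \<partial>PiM ?J (\<lambda>_. std_normal_distribution))"
    unfolding J using int(1) by (subst P.product_integral_insert) (auto simp: J)
  also have "\<dots>
    = (\<integral>x. (\<integral>t. g' (x(i := t)) \<partial>std_normal_distribution) \<partial>PiM ?J (\<lambda>_. std_normal_distribution))"
  proof (rule Bochner_Integration.integral_cong[OF refl])
    fix x :: "nat \<Rightarrow> real"
    obtain p q where "\<And>t. \<bar>g (x(i := t))\<bar> \<le> poly p t" "\<And>t. \<bar>g' (x(i := t))\<bar> \<le> poly q t"
      using bound[of x] by blast
    then show "(\<integral>t. t * g (x(i := t)) \<partial>std_normal_distribution)
      = (\<integral>t. g' (x(i := t)) \<partial>std_normal_distribution)"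
      by (intro gauss_ibp[of "\<lambda>t. g (x(i := t))" _ p q] deriv cont)
  qed
  also have "\<dots> = (\<integral>x. g' x \<partial>std_gaussian n)"
    unfolding J using int(2) by (subst P.product_integral_insert) (auto simp: J)
  finally show ?thesis .
qed

lemma poly_fun_line_bound:
  assumes "poly_fun n f"
  shows "\<exists>p. \<forall>t. \<bar>f (x(i := t))\<bar> \<le> poly p t"
proof -
  obtain p where p: "\<And>t. f (x(i := t)) = poly p t"
    using assms poly_deg_line[of n _ f x i] by (auto simp: poly_fun_def)
  show ?thesis
    unfolding p by (intro exI[of _ "1 + p\<^sup>2"]) (simp add: abs_le_one_plus_square)
qed

lemma poly_fun_line_cont: "poly_fun n f \<Longrightarrow> continuous_on A (\<lambda>t. f (x(i := t)))"
  using partial_DERIV by (meson DERIV_isCont continuous_at_imp_continuous_on)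

lemma integral_var_poly_fun:
  assumes "i < n" "poly_fun n f"
  shows "(\<integral>x. x i * f x \<partial>std_gaussian n) = (\<integral>x. partial i f x \<partial>std_gaussian n)"
  using assms
  by (intro std_gaussian_ibp poly_fun_line_bound[of n] poly_fun_line_cont[of n]
    partial_DERIV[of n]) auto

section \<open>The generator, the carre du champ and their integral identities\<close>

definition ou_gen :: "nat \<Rightarrow> ((nat \<Rightarrow> real) \<Rightarrow> real) \<Rightarrow> (nat \<Rightarrow> real) \<Rightarrow> real" where
  "ou_gen n u x = (\<Sum>i<n. partial i (partial i u) x - x i * partial i u x)"

definition \<Gamma> :: "nat \<Rightarrow> ((nat \<Rightarrow> real) \<Rightarrow> real) \<Rightarrow> ((nat \<Rightarrow> real) \<Rightarrow> real) \<Rightarrow> (nat \<Rightarrow> real) \<Rightarrow> real" where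
  "\<Gamma> n u v x = (\<Sum>i<n. partial i u x * partial i v x)"

lemma poly_fun_ou_gen [simp]: "poly_fun n u \<Longrightarrow> poly_fun n (ou_gen n u)"
  unfolding ou_gen_def[abs_def] by (intro poly_fun_sum) simp

lemma poly_fun_\<Gamma> [simp]: "poly_fun n u \<Longrightarrow> poly_fun n v \<Longrightarrow> poly_fun n (\<Gamma> n u v)"
  unfolding \<Gamma>_def[abs_def] by simp

lemma \<Gamma>_commute: "\<Gamma> n u v = \<Gamma> n v u"
  by (simp add: \<Gamma>_def fun_eq_iff mult.commute)

abbreviation gauss_mean :: "nat \<Rightarrow> ((nat \<Rightarrow> real) \<Rightarrow> real) \<Rightarrow> real" where
  "gauss_mean n f \<equiv> integral\<^sup>L (std_gaussian n) f"

lemma measure_std_gaussian_space [simp]: "measure (std_gaussian n) (space (std_gaussian n)) = 1"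
  by (rule prob_space.prob_space[OF prob_space_std_gaussian])

text \<open>Integration by parts in \<open>x i * (v x * partial i u x)\<close> yields a second-order
  term that cancels the one in \<open>ou_gen\<close> and leaves the energy. In particular the
  generator is symmetric on polynomials.\<close>

lemma gauss_mean_mult_ou_gen:
  assumes "poly_fun n u" "poly_fun n v"
  shows "gauss_mean n (\<lambda>x. v x * ou_gen n u x) = - gauss_mean n (\<Gamma> n v u)"
proof -
  have "gauss_mean n (\<lambda>x. x i * (v x * partial i u x)) =
      gauss_mean n (\<lambda>x. v x * partial i (partial i u) x)
        + gauss_mean n (\<lambda>x. partial i v x * partial i u x)"
    if "i < n" for i
    using that assms by (subst integral_var_poly_fun) (simp_all add: partial_mult[of n] add.commute)
  then have *: "(\<Sum>i<n. gauss_mean n (\<lambda>x. v x * partial i (partial i u) x)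
    - gauss_mean n (\<lambda>x. x i * (v x * partial i u x)))
      = (\<Sum>i<n. - gauss_mean n (\<lambda>x. partial i v x * partial i u x))"
    by (intro sum.cong) auto
  have "gauss_mean n (\<lambda>x. v x * ou_gen n u x)
    = gauss_mean n (\<lambda>x. \<Sum>i<n. v x * partial i (partial i u) x - x i * (v x * partial i u x))"
    by (simp add: ou_gen_def sum_distrib_left right_diff_distrib mult_ac)
  also have "\<dots> = - gauss_mean n (\<Gamma> n v u)"
    using assms * by (simp add: \<Gamma>_def[abs_def] sum_negf)
  finally show ?thesis .
qed

text \<open>Only the differentiated drift coefficient \<open>x i\<close> obstructs commutation.
  Differentiation therefore shifts eigenvalues by one, which underlies
  \<open>chaos_partial\<close>.\<close>

lemma partial_ou_gen:
  assumes "poly_fun n u" "i < n"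
  shows "partial i (ou_gen n u) = (\<lambda>x. ou_gen n (partial i u) x - partial i u x)"
proof -
  have 1: "partial i (\<lambda>x. partial j (partial j u) x - x j * partial j u x) =
      (\<lambda>x. partial j (partial j (partial i u)) x
        - ((if i = j then 1 else 0) * partial j u x + x j * partial j (partial i u) x))"
    if "j < n" for j
  proof -
    have "partial i (\<lambda>x. partial j (partial j u) x - x j * partial j u x) =
        (\<lambda>x. partial i (partial j (partial j u)) x
          - ((if i = j then 1 else 0) * partial j u x + x j * partial i (partial j u) x))"
      using assms that by (simp add: partial_diff[of n] partial_mult[of n] partial_var)
    also have "partial i (partial j u) = partial j (partial i u)"
      using assms by (intro partial_commute[of n])
    also have "partial i (partial j (partial j u)) = partial j (partial i (partial j u))"
      using assms by (intro partial_commute[of n]) simp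
    also have "partial i (partial j u) = partial j (partial i u)"
      using assms by (intro partial_commute[of n])
    finally show ?thesis .
  qed
  have "partial i (ou_gen n u)
    = (\<lambda>x. \<Sum>j<n. partial i (\<lambda>x. partial j (partial j u) x - x j * partial j u x) x)"
    unfolding ou_gen_def[abs_def] using assms by (intro partial_sum[of _ n]) simp
  also have "\<dots>
    = (\<lambda>x. \<Sum>j<n. partial j (partial j (partial i u)) x
      - ((if i = j then 1 else 0) * partial j u x + x j * partial j (partial i u) x))"
    by (intro ext sum.cong) (simp_all only: 1 lessThan_iff)
  also have "\<dots> = (\<lambda>x. ou_gen n (partial i u) x - (\<Sum>j<n. (if i = j then 1 else 0) * partial j u x))"
    by (simp add: fun_eq_iff ou_gen_def flip: sum_subtractf) (simp add: algebra_simps)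
  also have "(\<lambda>x. \<Sum>j<n. (if i = j then 1 else 0) * partial j u x) = partial i u"
    using assms by (simp add: if_distrib[of "\<lambda>c. c * _"] cong: if_cong)
  finally show ?thesis .
qed

lemma gauss_mean_nonneg: "(\<And>x. 0 \<le> f x) \<Longrightarrow> 0 \<le> gauss_mean n f"
  by (rule integral_nonneg_AE) simp

text \<open>The integrated Bochner identity: the sum over \<open>i\<close> is the mean squared norm
  of the Hessian. Two integrations by parts, with \<open>partial_ou_gen\<close> in between, give
  it.\<close>

lemma gauss_mean_ou_gen_sq:
  assumes "poly_fun n u"
  shows "gauss_mean n (\<lambda>x. (ou_gen n u x)\<^sup>2) =
    gauss_mean n (\<Gamma> n u u) + (\<Sum>i<n. gauss_mean n (\<Gamma> n (partial i u) (partial i u)))"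
proof -
  have "gauss_mean n (\<lambda>x. (ou_gen n u x)\<^sup>2) = - gauss_mean n (\<Gamma> n (ou_gen n u) u)"
    using gauss_mean_mult_ou_gen[of n u "ou_gen n u"] assms by (simp add: power2_eq_square)
  also have "\<dots> = (\<Sum>i<n. - gauss_mean n (\<lambda>x. partial i (ou_gen n u) x * partial i u x))"
    using assms by (simp add: \<Gamma>_def[abs_def] sum_negf)
  also have "\<dots>
    = (\<Sum>i<n. gauss_mean n (\<lambda>x. partial i u x * partial i u x)
      + gauss_mean n (\<Gamma> n (partial i u) (partial i u)))"
  proof (intro sum.cong refl)
    fix i assume "i \<in> {..<n}"
    then have "gauss_mean n (\<lambda>x. partial i (ou_gen n u) x * partial i u x)
        = gauss_mean n (\<lambda>x. partial i u x * ou_gen n (partial i u) x)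
          - gauss_mean n (\<lambda>x. partial i u x * partial i u x)"
      using assms by (simp add: partial_ou_gen algebra_simps)
    also have "gauss_mean n (\<lambda>x. partial i u x * ou_gen n (partial i u) x)
      = - gauss_mean n (\<Gamma> n (partial i u) (partial i u))"
      using assms by (intro gauss_mean_mult_ou_gen) auto
    finally show "- gauss_mean n (\<lambda>x. partial i (ou_gen n u) x * partial i u x) =
        gauss_mean n (\<lambda>x. partial i u x * partial i u x)
          + gauss_mean n (\<Gamma> n (partial i u) (partial i u))"
      by simp
  qed
  finally show ?thesis
    using assms by (simp add: sum.distrib \<Gamma>_def[abs_def])
qed

text \<open>
  The first bound for the partial derivatives of \<open>u\<close>, of degree \<open>D - 1\<close>, gives the second one
  for \<open>u\<close>, and expanding \<open>0 \<le> E[((L + D) u)\<^sup>2]\<close> then gives the first one for \<open>u\<close>.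
\<close>

lemma reverse_poincare:
  assumes "poly_deg n D u"
  shows "gauss_mean n (\<Gamma> n u u) \<le> D * gauss_mean n (\<lambda>x. (u x)\<^sup>2)"
    and "gauss_mean n (\<lambda>x. (ou_gen n u x)\<^sup>2) \<le> D * gauss_mean n (\<Gamma> n u u)"
proof -
  have hess: "gauss_mean n (\<lambda>x. (ou_gen n u x)\<^sup>2) \<le> D * gauss_mean n (\<Gamma> n u u)"
    if D: "poly_deg n D u" and IH: "\<And>i. D > 0 \<Longrightarrow> gauss_mean n (\<Gamma> n (partial i u) (partial i u))
      \<le> (D - 1) * gauss_mean n (\<lambda>x. (partial i u x)\<^sup>2)"
    for D u
  proof (cases D)
    case 0
    then have "partial i u = (\<lambda>x. 0)" for i
      using D partial_deg_0 by auto
    then show ?thesis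
      by (simp add: ou_gen_def \<Gamma>_def)
  next
    case (Suc E)
    have [simp]: "poly_fun n u"
      using D by (rule poly_funI)
    have "gauss_mean n (\<lambda>x. (ou_gen n u x)\<^sup>2)
      \<le> gauss_mean n (\<Gamma> n u u) + (\<Sum>i<n. (D - 1) * gauss_mean n (\<lambda>x. (partial i u x)\<^sup>2))"
      unfolding gauss_mean_ou_gen_sq[OF \<open>poly_fun n u\<close>] using IH Suc
      by (intro add_left_mono sum_mono) simp
    also have "\<dots> = D * gauss_mean n (\<Gamma> n u u)"
      using Suc by (simp add: \<Gamma>_def[abs_def] power2_eq_square sum_distrib_left sum.distrib
        algebra_simps)
    finally show ?thesis .
  qed
  have key: "gauss_mean n (\<Gamma> n u u) \<le> D * gauss_mean n (\<lambda>x. (u x)\<^sup>2)"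
    if "poly_deg n D u" for D u
    using that
  proof (induction D arbitrary: u)
    case 0
    then have "partial i u = (\<lambda>x. 0)" for i
      using partial_deg_0 by auto
    then show ?case
      by (simp add: \<Gamma>_def)
  next
    case (Suc D)
    have [simp]: "poly_fun n u"
      using Suc.prems by (rule poly_funI)
    define S where "S = gauss_mean n (\<Gamma> n u u)"
    have "gauss_mean n (\<lambda>x. (ou_gen n u x)\<^sup>2) \<le> Suc D * S"
      unfolding S_def using Suc.IH[OF poly_deg_partial[OF Suc.prems, simplified]] Suc.prems
      by (intro hess) auto
    moreover have "0 \<le> gauss_mean n (\<lambda>x. (ou_gen n u x + Suc D * u x)\<^sup>2)"
      by (intro gauss_mean_nonneg) simp
    moreover have "gauss_mean n (\<lambda>x. (ou_gen n u x + Suc D * u x)\<^sup>2)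
      = gauss_mean n (\<lambda>x. (ou_gen n u x)\<^sup>2)
       + Suc D ^ 2 * gauss_mean n (\<lambda>x. (u x)\<^sup>2) + 2 * Suc D * gauss_mean n (\<lambda>x. u x * ou_gen n u x)"
    proof -
      have "gauss_mean n (\<lambda>x. (ou_gen n u x + Suc D * u x)\<^sup>2) = 
          gauss_mean n (\<lambda>x. (ou_gen n u x)\<^sup>2 + Suc D ^ 2 * (u x)\<^sup>2
            + 2 * Suc D * (u x * ou_gen n u x))"
        by (intro Bochner_Integration.integral_cong) (simp_all add: power2_eq_square algebra_simps)
      then show ?thesis
        by simp
    qed
    moreover have "gauss_mean n (\<lambda>x. u x * ou_gen n u x) = - S"
      unfolding S_def by (rule gauss_mean_mult_ou_gen) simp_all
    ultimately have "0 \<le> Suc D * (Suc D * gauss_mean n (\<lambda>x. (u x)\<^sup>2) - S)"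
      by (simp add: power2_eq_square algebra_simps)
    then have "0 \<le> Suc D * gauss_mean n (\<lambda>x. (u x)\<^sup>2) - S"
      by (simp add: zero_le_mult_iff del: of_nat_Suc)
    then show ?case
      by (simp add: S_def)
  qed
  show "gauss_mean n (\<Gamma> n u u) \<le> D * gauss_mean n (\<lambda>x. (u x)\<^sup>2)"
    by (rule key) fact
  show "gauss_mean n (\<lambda>x. (ou_gen n u x)\<^sup>2) \<le> D * gauss_mean n (\<Gamma> n u u)"
    using key[OF poly_deg_partial[OF assms]] by (intro hess assms) (simp add: of_nat_diff)
qed

text \<open>On polynomials of degree at most \<open>D\<close>, the eigenvalues of L + D lie between
  0 and \<open>D\<close>, where t^2 \<le> D t. In place of an eigenbasis, expanding both sides
  reduces the claim to \<open>reverse_poincare(2)\<close>.\<close>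

lemma spectral_bound:
  assumes "poly_deg n D u"
  shows "gauss_mean n (\<lambda>x. (ou_gen n u x + D * u x)\<^sup>2)
    \<le> D * gauss_mean n (\<lambda>x. u x * (ou_gen n u x + D * u x))"
proof -
  have [simp]: "poly_fun n u"
    using assms by (rule poly_funI)
  define S where "S = gauss_mean n (\<Gamma> n u u)"
  have uL: "gauss_mean n (\<lambda>x. u x * ou_gen n u x) = - S"
    unfolding S_def by (rule gauss_mean_mult_ou_gen) simp_all
  have "gauss_mean n (\<lambda>x. (ou_gen n u x + D * u x)\<^sup>2) =
      gauss_mean n (\<lambda>x. (ou_gen n u x)\<^sup>2 + D ^ 2 * (u x)\<^sup>2 + 2 * D * (u x * ou_gen n u x))"
    by (intro Bochner_Integration.integral_cong) (simp_all add: power2_eq_square algebra_simps)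
  also have "\<dots> = gauss_mean n (\<lambda>x. (ou_gen n u x)\<^sup>2) + D ^ 2 * gauss_mean n (\<lambda>x. (u x)\<^sup>2)
    - 2 * D * S"
    by (simp add: uL)
  also have "\<dots> \<le> D * (D * gauss_mean n (\<lambda>x. (u x)\<^sup>2) - S)"
    using reverse_poincare(2)[OF assms] by (simp add: S_def power2_eq_square algebra_simps)
  also have "D * gauss_mean n (\<lambda>x. (u x)\<^sup>2) - S
    = gauss_mean n (\<lambda>x. u x * ou_gen n u x + D * (u x)\<^sup>2)"
    by (simp add: uL)
  also have "\<dots> = gauss_mean n (\<lambda>x. u x * (ou_gen n u x + D * u x))"
    by (intro Bochner_Integration.integral_cong) (simp_all add: power2_eq_square algebra_simps)
  finally show ?thesis .
qed

section \<open>Wiener chaos\<close>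

text \<open>
  The eigenvalue equation characterises the \<open>p\<close>-th Wiener chaos among polynomials. The degree bound
  follows from it, but would need a Hermite expansion.
\<close>

definition chaos :: "nat \<Rightarrow> nat \<Rightarrow> ((nat \<Rightarrow> real) \<Rightarrow> real) \<Rightarrow> bool" where
  "chaos n p F \<longleftrightarrow> poly_deg n p F \<and> ou_gen n F = (\<lambda>x. - real p * F x)"

lemma chaos_poly_fun [simp]: "chaos n p F \<Longrightarrow> poly_fun n F"
  by (auto simp: chaos_def intro: poly_funI)

text \<open>By \<open>partial_ou_gen\<close> a derivative lowers the eigenvalue by one. For
  \<open>p = 0\<close> the truncated \<open>p - 1\<close> is harmless, because the derivative is the
  zero function.\<close>

lemma chaos_partial:
  assumes "chaos n p F" "i < n"
  shows "chaos n (p - 1) (partial i F)"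
proof (cases "p = 0")
  case True
  then have "partial i F = (\<lambda>x. 0)"
    using assms partial_deg_0 by (auto simp: chaos_def)
  then show ?thesis
    unfolding \<open>partial i F = (\<lambda>x. 0)\<close> by (simp add: chaos_def ou_gen_def fun_eq_iff poly_deg_const)
next
  case False
  have F: "poly_fun n F"
    using assms by simp
  have "ou_gen n F = (\<lambda>x. - real p * F x)"
    using assms by (simp add: chaos_def)
  then have "partial i (ou_gen n F) = (\<lambda>x. - real p * partial i F x)"
    by (simp only: partial_cmult[OF F])
  then have "ou_gen n (partial i F) x - partial i F x = - real p * partial i F x" for x
    using partial_ou_gen[OF F assms(2)] by metis
  then have "ou_gen n (partial i F) = (\<lambda>x. - (p - 1) * partial i F x)"
    using False by (auto simp: fun_eq_iff algebra_simps of_nat_diff)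
  then show ?thesis
    using assms False poly_deg_partial[of n p F i] by (simp add: chaos_def of_nat_diff)
qed

lemma ou_gen_mult:
  assumes "poly_fun n u" "poly_fun n v"
  shows "ou_gen n (\<lambda>x. u x * v x) = (\<lambda>x. u x * ou_gen n v x + v x * ou_gen n u x + 2 * \<Gamma> n u v x)"
proof -
  have "partial i (partial i (\<lambda>x. u x * v x)) x
    = partial i (partial i u) x * v x + u x * partial i (partial i v) x
     + 2 * (partial i u x * partial i v x)" for i x
    using assms by (simp add: partial_mult[of n] partial_add[of n])
  then show ?thesis
    using assms
    by (simp add: ou_gen_def \<Gamma>_def partial_mult[of n] fun_eq_iff sum_distrib_left sum.distrib
      sum_subtractf algebra_simps)
qed

lemma \<Gamma>_mult_left:
  assumes "poly_fun n u" "poly_fun n v"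
  shows "\<Gamma> n (\<lambda>x. u x * v x) w = (\<lambda>x. u x * \<Gamma> n v w x + v x * \<Gamma> n u w x)"
  using assms
  by (simp add: \<Gamma>_def partial_mult[of n] fun_eq_iff sum_distrib_left sum.distrib algebra_simps)

lemma \<Gamma>_mult_right:
  assumes "poly_fun n u" "poly_fun n v"
  shows "\<Gamma> n w (\<lambda>x. u x * v x) = (\<lambda>x. u x * \<Gamma> n w v x + v x * \<Gamma> n w u x)"
  using assms \<Gamma>_mult_left by (simp add: \<Gamma>_commute[of n w])

section \<open>Moment estimates for the carre du champ of chaos elements\<close>

lemma ou_gen_mult_chaos:
  assumes "chaos n p F" "chaos n q G"
  shows "ou_gen n (\<lambda>x. F x * G x) x + real (p + q) * (F x * G x) = 2 * \<Gamma> n F G x"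
  using assms by (subst ou_gen_mult) (auto simp: chaos_def intro: poly_funI simp: algebra_simps)

text \<open>This is \<open>spectral_bound\<close> for \<open>F G\<close>, of degree
  \<open>p + q\<close>, on which the shifted generator gives twice \<Gamma>(F, G). As the left side
  is nonnegative, it also settles the sign of E[F G \<Gamma>(F, G)] when \<open>p + q\<close> is
  positive.\<close>

lemma \<Gamma>_chaos_sq_le:
  assumes F: "chaos n p F" and G: "chaos n q G"
  shows "2 * gauss_mean n (\<lambda>x. (\<Gamma> n F G x)\<^sup>2)
    \<le> real (p + q) * gauss_mean n (\<lambda>x. F x * G x * \<Gamma> n F G x)"
proof -
  have "poly_deg n (p + q) (\<lambda>x. F x * G x)"
    using F G by (intro poly_deg_mult) (auto simp: chaos_def)
  from spectral_bound[OF this] have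
    "gauss_mean n (\<lambda>x. (2 * \<Gamma> n F G x)\<^sup>2)
      \<le> real (p + q) * gauss_mean n (\<lambda>x. F x * G x * (2 * \<Gamma> n F G x))"
    unfolding ou_gen_mult_chaos[OF F G] .
  also have "gauss_mean n (\<lambda>x. F x * G x * (2 * \<Gamma> n F G x))
    = 2 * gauss_mean n (\<lambda>x. F x * G x * \<Gamma> n F G x)"
    by (subst integral_mult_right_zero[symmetric]) (simp only: mult_ac)
  finally show ?thesis
    by (simp add: power_mult_distrib)
qed

lemma chaos_energy:
  assumes F: "chaos n p F"
  shows "gauss_mean n (\<Gamma> n F F) = p * gauss_mean n (\<lambda>x. (F x)\<^sup>2)"
proof -
  have "gauss_mean n (\<Gamma> n F F) = - gauss_mean n (\<lambda>x. F x * ou_gen n F x)"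
    using gauss_mean_mult_ou_gen[of n F F] F by simp
  also have "(\<lambda>x. F x * ou_gen n F x) = (\<lambda>x. - real p * (F x)\<^sup>2)"
    using F by (simp add: chaos_def power2_eq_square mult_ac)
  finally show ?thesis
    by simp
qed

text \<open>
  The induction hypothesis applies to the pairs \<open>(\<partial>\<^sub>i F, G)\<close> and \<open>(F, \<partial>\<^sub>i G)\<close>, which appear when
  the reverse Poincare inequality for \<open>F G\<close> is expanded; the remaining cross term
  \<open>E[F G \<Gamma>(F, G)]\<close> is nonnegative.
\<close>

lemma chaos_sq_mult_sq_ge:
  "chaos n p F \<Longrightarrow> chaos n q G \<Longrightarrow>
    gauss_mean n (\<lambda>x. (F x)\<^sup>2) * gauss_mean n (\<lambda>x. (G x)\<^sup>2) \<le> gauss_mean n (\<lambda>x. (F x)\<^sup>2 * (G x)\<^sup>2)"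
proof (induction "p + q" arbitrary: p q F G)
  case 0
  then obtain a b where "F = (\<lambda>x. a)" "G = (\<lambda>x. b)"
    by (auto simp: chaos_def dest!: poly_deg_0D)
  then show ?case
    by simp
next
  case (Suc s)
  note F = \<open>chaos n p F\<close> and G = \<open>chaos n q G\<close>
  have [simp]: "poly_fun n F" "poly_fun n G"
    using F G by auto
  define A where "A = gauss_mean n (\<lambda>x. (F x)\<^sup>2)"
  define B where "B = gauss_mean n (\<lambda>x. (G x)\<^sup>2)"
  have partial_0: "partial i H = (\<lambda>x. 0)" if "chaos n 0 H" for i H
    using that partial_deg_0 by (auto simp: chaos_def)
  have 1: "gauss_mean n (\<lambda>x. (partial i F x)\<^sup>2) * B
    \<le> gauss_mean n (\<lambda>x. (partial i F x)\<^sup>2 * (G x)\<^sup>2)"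
    if "i < n" for i
    using Suc.hyps(1)[of "p - 1" q "partial i F" G] Suc.hyps(2) chaos_partial[OF F that] G
      partial_0[of F i] F
    unfolding B_def by (cases "p = 0") auto
  have 2: "A * gauss_mean n (\<lambda>x. (partial i G x)\<^sup>2)
    \<le> gauss_mean n (\<lambda>x. (F x)\<^sup>2 * (partial i G x)\<^sup>2)"
    if "i < n" for i
    using Suc.hyps(1)[of p "q - 1" F "partial i G"] Suc.hyps(2) chaos_partial[OF G that] F
      partial_0[of G i] G
    unfolding A_def by (cases "q = 0") auto
  define X where "X = gauss_mean n (\<lambda>x. F x * G x * \<Gamma> n F G x)"
  \<comment> \<open>The first term is the sum of the energies of \<open>F\<close> and
    \<open>G\<close>, weighted by \<open>B\<close> and \<open>A\<close>. Adding \<open>2 * X\<close>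
    prepares the full energy of \<open>F G\<close>, and integrating by parts returns
    \<open>- 2 * X\<close>; the surplus \<open>4 * X\<close> is dropped at the end.\<close>
  have "real (p + q) * (A * B) + 2 * X = (\<Sum>i<n. gauss_mean n (\<lambda>x. (partial i F x)\<^sup>2) * B)
    + (\<Sum>i<n. A * gauss_mean n (\<lambda>x. (partial i G x)\<^sup>2)) + 2 * X"
    using chaos_energy[OF F] chaos_energy[OF G]
    by (simp add: A_def B_def \<Gamma>_def[abs_def] power2_eq_square algebra_simps flip: sum_distrib_left
      sum_distrib_right)
  also have "\<dots> \<le> (\<Sum>i<n. gauss_mean n (\<lambda>x. (partial i F x)\<^sup>2 * (G x)\<^sup>2))
    + (\<Sum>i<n. gauss_mean n (\<lambda>x. (F x)\<^sup>2 * (partial i G x)\<^sup>2)) + 2 * X"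
    by (intro add_mono sum_mono order_refl 1 2) auto
  also have "\<dots>
    = gauss_mean n (\<lambda>x. (\<Sum>i<n. (partial i F x)\<^sup>2 * (G x)\<^sup>2) + (\<Sum>i<n. (F x)\<^sup>2 * (partial i G x)\<^sup>2)
      + 2 * (F x * G x * \<Gamma> n F G x))"
    by (simp add: X_def)
  also have "(\<lambda>x. (\<Sum>i<n. (partial i F x)\<^sup>2 * (G x)\<^sup>2) + (\<Sum>i<n. (F x)\<^sup>2 * (partial i G x)\<^sup>2)
    + 2 * (F x * G x * \<Gamma> n F G x))
      = \<Gamma> n (\<lambda>x. F x * G x) (\<lambda>x. F x * G x)"
    by (simp add: \<Gamma>_def partial_mult[of n] fun_eq_iff sum_distrib_left power2_eq_square
      algebra_simps flip: sum.distrib)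
  also have "gauss_mean n \<dots> = - gauss_mean n (\<lambda>x. F x * G x * ou_gen n (\<lambda>x. F x * G x) x)"
    by (subst gauss_mean_mult_ou_gen) simp_all
  also have "\<dots>
    = gauss_mean n (\<lambda>x. real (p + q) * ((F x)\<^sup>2 * (G x)\<^sup>2) - 2 * (F x * G x * \<Gamma> n F G x))"
  proof -
    have eq: "ou_gen n (\<lambda>x. F x * G x) x = 2 * \<Gamma> n F G x - real (p + q) * (F x * G x)" for x
      using ou_gen_mult_chaos[OF F G, of x] by simp
    show ?thesis
      unfolding eq
      by (simp add: power2_eq_square algebra_simps flip: Bochner_Integration.integral_minus)
  qed
  also have "\<dots> = real (p + q) * gauss_mean n (\<lambda>x. (F x)\<^sup>2 * (G x)\<^sup>2) - 2 * X"
    by (simp add: X_def)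
  finally have "real (p + q) * (A * B) + 4 * X
    \<le> real (p + q) * gauss_mean n (\<lambda>x. (F x)\<^sup>2 * (G x)\<^sup>2)"
    by simp
  moreover have "0 \<le> X"
  proof -
    have "0 \<le> gauss_mean n (\<lambda>x. (\<Gamma> n F G x)\<^sup>2)"
      by (intro gauss_mean_nonneg) simp
    then have "0 \<le> real (p + q) * X"
      using \<Gamma>_chaos_sq_le[OF F G] unfolding X_def by linarith
    then show ?thesis
      using Suc.hyps(2) by (simp add: zero_le_mult_iff)
  qed
  ultimately have "real (p + q) * (A * B) \<le> real (p + q) * gauss_mean n (\<lambda>x. (F x)\<^sup>2 * (G x)\<^sup>2)"
    by linarith
  then show ?case
    using Suc.hyps(2) unfolding A_def B_def by (subst (asm) mult_le_cancel_left_pos) auto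
qed

text \<open>Apply \<open>spectral_bound\<close> to the centred square \<open>u\<close>, of degree at
  most 2p: the shifted generator maps it to twice the deviation of \<Gamma>(F, F) from its mean
  \<open>p * s\<close>. The right-hand side then evaluates to a multiple of the fourth
  cumulant.\<close>

lemma chaos_fourth_moment:
  assumes F: "chaos n p F"
  defines "s \<equiv> gauss_mean n (\<lambda>x. (F x)\<^sup>2)"
  shows "3 * gauss_mean n (\<lambda>x. (\<Gamma> n F F x - real p * s)\<^sup>2)
    \<le> (real p)\<^sup>2 * (gauss_mean n (\<lambda>x. F x ^ 4) - 3 * s\<^sup>2)"
proof -
  have [simp]: "poly_fun n F"
    using F by auto
  define u where "u = (\<lambda>x. F x * F x - s)"
  have "poly_deg n (p + p) u"
    unfolding u_def using F by (intro poly_deg_diff poly_deg_mult poly_deg_const)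
      (auto simp: chaos_def)
  moreover have ou_gen_u: "ou_gen n u x + real (p + p) * u x = 2 * (\<Gamma> n F F x - real p * s)" for x
  proof -
    have "ou_gen n u x = ou_gen n (\<lambda>x. F x * F x) x"
      unfolding u_def by (simp add: ou_gen_def partial_diff[of n])
    then show ?thesis
      using ou_gen_mult_chaos[OF F F, of x] by (simp add: u_def algebra_simps)
  qed
  moreover define R where "R = gauss_mean n (\<lambda>x. u x * (2 * (\<Gamma> n F F x - real p * s)))"
  ultimately have 1: "gauss_mean n (\<lambda>x. (2 * (\<Gamma> n F F x - real p * s))\<^sup>2) \<le> (p + p) * R"
    using spectral_bound[of n "p + p" u] unfolding ou_gen_u by simp
  have 2: "R =
      gauss_mean n (\<lambda>x. 2 * ((F x)\<^sup>2 * \<Gamma> n F F x) - 2 * p * s * (F x)\<^sup>2 - 2 * s * \<Gamma> n F F x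
        + 2 * p * s\<^sup>2)"
    unfolding R_def by (intro Bochner_Integration.integral_cong)
      (simp_all add: u_def power2_eq_square algebra_simps)
  \<comment> \<open>Integrate the cube of \<open>F\<close> against the eigenvalue equation for
    \<open>F\<close>; the chain rule for \<Gamma> produces the factor 3.\<close>
  have 3: "3 * gauss_mean n (\<lambda>x. (F x)\<^sup>2 * \<Gamma> n F F x) = p * gauss_mean n (\<lambda>x. F x ^ 4)"
  proof -
    have "\<Gamma> n (\<lambda>x. F x * (F x * F x)) F = (\<lambda>x. 3 * ((F x)\<^sup>2 * \<Gamma> n F F x))"
      by (simp add: \<Gamma>_mult_left fun_eq_iff power2_eq_square algebra_simps)
    then have "gauss_mean n (\<lambda>x. F x * (F x * F x) * ou_gen n F x)
      = - (3 * gauss_mean n (\<lambda>x. (F x)\<^sup>2 * \<Gamma> n F F x))"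
      by (subst gauss_mean_mult_ou_gen) simp_all
    moreover have "(\<lambda>x. F x * (F x * F x) * ou_gen n F x) = (\<lambda>x. - real p * F x ^ 4)"
      using F by (simp add: chaos_def fun_eq_iff power4_eq_xxxx)
    ultimately show ?thesis
      by simp
  qed
  have 4: "gauss_mean n (\<lambda>x. (2 * (\<Gamma> n F F x - real p * s))\<^sup>2)
    = 4 * gauss_mean n (\<lambda>x. (\<Gamma> n F F x - real p * s)\<^sup>2)"
    by (simp only: power_mult_distrib) simp
  have 5: "gauss_mean n (\<lambda>x. 2 * ((F x)\<^sup>2 * \<Gamma> n F F x) - 2 * p * s * (F x)\<^sup>2 - 2 * s * \<Gamma> n F F x
    + 2 * p * s\<^sup>2)
      = 2 * gauss_mean n (\<lambda>x. (F x)\<^sup>2 * \<Gamma> n F F x) - 2 * p * s\<^sup>2"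
    using chaos_energy[OF F] by (simp add: s_def[symmetric] power2_eq_square[of s])
  have R: "3 * R = 2 * p * gauss_mean n (\<lambda>x. F x ^ 4) - 6 * p * s\<^sup>2"
    using 2 3 5 by linarith
  have "12 * gauss_mean n (\<lambda>x. (\<Gamma> n F F x - p * s)\<^sup>2) \<le> 2 * p * (3 * R)"
    using 1 4 by (simp add: algebra_simps)
  then show ?thesis
    unfolding R by (simp add: power2_eq_square[of "real p"] algebra_simps)
qed

text \<open>Compute the mean of G^2 L(F^2) in two ways, by parts and by the product formula. The
  cross moment is thereby reduced to the covariance of the squares and the fluctuation of
  \<Gamma>(F, F).\<close>

lemma chaos_cross_identity:
  assumes F: "chaos n p F" and G: "poly_fun n G"
  shows "2 * gauss_mean n (\<lambda>x. F x * G x * \<Gamma> n F G x) =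
    p * gauss_mean n (\<lambda>x. (F x)\<^sup>2 * (G x)\<^sup>2) - gauss_mean n (\<lambda>x. (G x)\<^sup>2 * \<Gamma> n F F x)"
proof -
  have [simp]: "poly_fun n F" "poly_fun n G"
    using F G by auto
  have "\<Gamma> n (\<lambda>x. G x * G x) (\<lambda>x. F x * F x) = (\<lambda>x. 4 * (F x * G x * \<Gamma> n F G x))"
    by (simp add: \<Gamma>_mult_left \<Gamma>_mult_right fun_eq_iff \<Gamma>_commute[of n G F])
  then have "gauss_mean n (\<lambda>x. G x * G x * ou_gen n (\<lambda>x. F x * F x) x)
    = - (4 * gauss_mean n (\<lambda>x. F x * G x * \<Gamma> n F G x))"
    by (subst gauss_mean_mult_ou_gen) simp_all
  moreover have "(\<lambda>x. G x * G x * ou_gen n (\<lambda>x. F x * F x) x) =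
     (\<lambda>x. 2 * ((G x)\<^sup>2 * \<Gamma> n F F x) - 2 * p * ((F x)\<^sup>2 * (G x)\<^sup>2))"
  proof
    fix x
    have eq: "ou_gen n (\<lambda>x. F x * F x) x = 2 * \<Gamma> n F F x - (p + p) * (F x * F x)"
      using ou_gen_mult_chaos[OF F F, of x] by simp
    show "G x * G x * ou_gen n (\<lambda>x. F x * F x) x
      = 2 * ((G x)\<^sup>2 * \<Gamma> n F F x) - 2 * p * ((F x)\<^sup>2 * (G x)\<^sup>2)"
      unfolding eq by (simp add: power2_eq_square algebra_simps)
  qed
  ultimately show ?thesis
    by (simp add: algebra_simps)
qed

lemma cauchy_schwarz_gauss_mean:
  assumes [simp]: "poly_fun n u" "poly_fun n v"
  shows "\<bar>gauss_mean n (\<lambda>x. u x * v x)\<bar>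
    \<le> sqrt (gauss_mean n (\<lambda>x. (u x)\<^sup>2)) * sqrt (gauss_mean n (\<lambda>x. (v x)\<^sup>2))"
proof -
  define a where "a = gauss_mean n (\<lambda>x. (u x)\<^sup>2)"
  define b where "b = gauss_mean n (\<lambda>x. (v x)\<^sup>2)"
  define c where "c = gauss_mean n (\<lambda>x. u x * v x)"
  have "0 \<le> a" "0 \<le> b"
    unfolding a_def b_def by (intro gauss_mean_nonneg; simp)+
  \<comment> \<open>A discriminant argument: for nonzero \<open>a\<close> the quadratic is evaluated
    at its minimiser \<open>- c / a\<close>; for \<open>a = 0\<close> and nonzero \<open>c\<close>
    it is linear and takes the value -1 somewhere.\<close>
  have q: "0 \<le> a * t\<^sup>2 + 2 * c * t + b" for t
  proof -
    have "0 \<le> gauss_mean n (\<lambda>x. (t * u x + v x)\<^sup>2)"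
      by (intro gauss_mean_nonneg) simp
    also have "\<dots> = gauss_mean n (\<lambda>x. t\<^sup>2 * (u x)\<^sup>2 + 2 * t * (u x * v x) + (v x)\<^sup>2)"
      by (intro Bochner_Integration.integral_cong) (simp_all add: power2_eq_square algebra_simps)
    also have "\<dots> = a * t\<^sup>2 + 2 * c * t + b"
      by (simp add: a_def b_def c_def)
    finally show ?thesis .
  qed
  have "c\<^sup>2 \<le> a * b"
  proof (cases "a = 0")
    case True
    have "c = 0"
    proof (rule ccontr)
      assume "c \<noteq> 0"
      then show False
        using q[of "- (b + 1) / (2 * c)"] True by simp
    qed
    then show ?thesis
      using True by simp
  next
    case False
    then have "0 \<le> b - c\<^sup>2 / a"
      using q[of "- c / a"] by (simp add: power2_eq_square field_simps)
    then show ?thesis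
      using False \<open>0 \<le> a\<close> by (simp add: field_simps)
  qed
  then have "\<bar>c\<bar> \<le> sqrt (a * b)"
    by (metis real_sqrt_abs real_sqrt_le_mono)
  then show ?thesis
    by (simp add: a_def b_def c_def real_sqrt_mult)
qed

section \<open>Homogeneous multilinear polynomials as chaos elements, and orthogonality of the
  chaoses\<close>

lemma partial_monom:
  assumes "I \<subseteq> {..<n}"
  shows "partial i (\<lambda>x. \<Prod>j\<in>I. x j) = (\<lambda>x. if i \<in> I then \<Prod>j\<in>I - {i}. x j else 0)"
proof (cases "i \<in> I")
  case True
  then have "(\<lambda>x. \<Prod>j\<in>I. x j) = (\<lambda>x. x i * (\<Prod>j\<in>I - {i}. x j :: real))"
    using assms finite_subset[of I] by (simp add: prod.remove[of I i] fun_eq_iff)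
  moreover have "partial i (\<lambda>x. x i * (\<Prod>j\<in>I - {i}. x j)) = (\<lambda>x. \<Prod>j\<in>I - {i}. x j)"
    by (rule ext, rule partial_eqI) (auto intro!: derivative_eq_intros)
  ultimately show ?thesis
    using True by simp
next
  case False
  then have "(\<Prod>j\<in>I. (x(i := t)) j) = (\<Prod>j\<in>I. x j)" for x :: "nat \<Rightarrow> real" and t
    by (intro prod.cong) auto
  then show ?thesis
    using False by (auto intro!: ext partial_eqI simp del: fun_upd_apply)
qed

text \<open>Multilinearity enters here: pure second derivatives vanish, so the generator reduces to
  minus the Euler operator, and each of the \<open>card I\<close> variables returns one copy of the
  monomial.\<close>

lemma chaos_monom:
  assumes I: "I \<subseteq> {..<n}"
  shows "chaos n (card I) (\<lambda>x. \<Prod>j\<in>I. x j)"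
proof -
  have 1: "partial i (partial i (\<lambda>x. \<Prod>j\<in>I. x j)) = (\<lambda>x. 0)" for i
  proof (cases "i \<in> I")
    case True
    then show ?thesis
      using I partial_monom[of "I - {i}" n i] by (subst partial_monom[OF I]) auto
  next
    case False
    then show ?thesis
      by (subst partial_monom[OF I]) auto
  qed
  have "ou_gen n (\<lambda>x. \<Prod>j\<in>I. x j) x = - real (card I) * (\<Prod>j\<in>I. x j)" for x
  proof -
    have "ou_gen n (\<lambda>x. \<Prod>j\<in>I. x j) x = (\<Sum>i<n. if i \<in> I then - (\<Prod>j\<in>I. x j) else 0)"
      unfolding ou_gen_def 1 using finite_subset[OF I]
      by (intro sum.cong) (auto simp: partial_monom[OF I] prod.remove[of I])
    also have "\<dots> = (\<Sum>i\<in>I. - (\<Prod>j\<in>I. x j))"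
      using I by (subst sum.inter_restrict[symmetric]) (auto simp: Int_absorb1)
    finally show ?thesis
      by simp
  qed
  then show ?thesis
    using poly_deg_prod[OF finite_subset[OF I finite_lessThan] I]
    by (simp add: chaos_def fun_eq_iff)
qed

lemma chaos_0 [simp]: "chaos n p (\<lambda>x. 0)"
  by (simp add: chaos_def ou_gen_def[abs_def] poly_deg_const)

lemma chaos_cmult:
  assumes "chaos n p F"
  shows "chaos n p (\<lambda>x. c * F x)"
proof -
  have "poly_fun n F"
    using assms by simp
  then have "ou_gen n (\<lambda>x. c * F x) = (\<lambda>x. c * ou_gen n F x)"
    by (simp add: ou_gen_def fun_eq_iff partial_cmult[of n] sum_distrib_left right_diff_distrib
      mult.left_commute)
  then show ?thesis
    using assms by (simp add: chaos_def poly_deg_cmult mult.left_commute)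
qed

lemma chaos_add:
  assumes "chaos n p F" "chaos n p G"
  shows "chaos n p (\<lambda>x. F x + G x)"
proof -
  have "poly_fun n F" "poly_fun n G"
    using assms by auto
  then have "ou_gen n (\<lambda>x. F x + G x) = (\<lambda>x. ou_gen n F x + ou_gen n G x)"
    by (simp add: ou_gen_def fun_eq_iff partial_add[of n] distrib_left sum.distrib sum_subtractf)
  then show ?thesis
    using assms by (simp add: chaos_def poly_deg_add distrib_left)
qed

lemma chaos_sum: "(\<And>i. i \<in> A \<Longrightarrow> chaos n p (f i)) \<Longrightarrow> chaos n p (\<lambda>x. \<Sum>i\<in>A. f i x)"
  by (induction A rule: infinite_finite_induct) (auto intro: chaos_add)

lemma chaos_hom_component: "chaos n m (hom_component n \<alpha> m)"
  unfolding hom_component_def[abs_def]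
  by (intro chaos_sum chaos_cmult) (use chaos_monom in auto)

lemma chaos_orthogonal:
  assumes F: "chaos n p F" and G: "chaos n q G" and "p \<noteq> q"
  shows "gauss_mean n (\<lambda>x. F x * G x) = 0"
proof -
  have [simp]: "poly_fun n F" "poly_fun n G"
    using F G by auto
  have "gauss_mean n (\<lambda>x. F x * ou_gen n G x) = gauss_mean n (\<lambda>x. G x * ou_gen n F x)"
    by (simp add: gauss_mean_mult_ou_gen \<Gamma>_commute[of n F])
  moreover have "(\<lambda>x. F x * ou_gen n G x) = (\<lambda>x. - real q * (F x * G x))"
    "(\<lambda>x. G x * ou_gen n F x) = (\<lambda>x. - real p * (F x * G x))"
    using F G by (simp_all add: chaos_def mult_ac)
  ultimately have "real q * gauss_mean n (\<lambda>x. F x * G x) = real p * gauss_mean n (\<lambda>x. F x * G x)"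
    by simp
  then show ?thesis
    using \<open>p \<noteq> q\<close> by simp
qed

lemma chaos_mean_0: "chaos n p F \<Longrightarrow> p \<noteq> 0 \<Longrightarrow> gauss_mean n F = 0"
  using chaos_orthogonal[of n p F 0 "\<lambda>x. 1"]
  by (simp add: chaos_def ou_gen_def[abs_def] poly_deg_const)

section \<open>Sums of chaoses with nonnegative mixed moments\<close>

text \<open>Isserlis' pairing sum, evaluated as if the components were independent centred Gaussians.\<close>

definition pairing_sum :: "(nat \<Rightarrow> real) \<Rightarrow> nat \<Rightarrow> nat \<Rightarrow> nat \<Rightarrow> nat \<Rightarrow> real" where
  "pairing_sum s i j k l = (if i = j \<and> k = l then s i * s k else 0)
    + (if i = k \<and> j = l then s i * s j else 0) + (if i = l \<and> j = k then s i * s j else 0)"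

text \<open>Each of the three pairings contributes the square of the sum of the variances. The
  conditions are nested with the one on \<open>l\<close> outermost so that the inner sums
  collapse.\<close>

lemma sum_pairing_sum:
  assumes "finite A"
  shows "(\<Sum>i\<in>A. \<Sum>j\<in>A. \<Sum>k\<in>A. \<Sum>l\<in>A. pairing_sum s i j k l) = 3 * (\<Sum>i\<in>A. s i)\<^sup>2"
proof -
  have [simp]: "(\<Sum>k\<in>A. if P then f k else 0) = (if P then \<Sum>k\<in>A. f k else 0)"
    for P and f :: "nat \<Rightarrow> real"
    by simp
  have "(\<Sum>i\<in>A. \<Sum>j\<in>A. \<Sum>k\<in>A. \<Sum>l\<in>A. pairing_sum s i j k l) = 
    (\<Sum>i\<in>A. \<Sum>j\<in>A. \<Sum>k\<in>A. \<Sum>l\<in>A. if l = k then (if i = j then s i * s k else 0) else 0) +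
    (\<Sum>i\<in>A. \<Sum>j\<in>A. \<Sum>k\<in>A. \<Sum>l\<in>A. if l = j then (if k = i then s i * s j else 0) else 0) +
    (\<Sum>i\<in>A. \<Sum>j\<in>A. \<Sum>k\<in>A. \<Sum>l\<in>A. if l = i then (if k = j then s i * s j else 0) else 0)"
    unfolding pairing_sum_def sum.distrib
    by (intro arg_cong2[where f = "(+)"] sum.cong refl) auto
  also have "\<dots> = (\<Sum>i\<in>A. \<Sum>j\<in>A. if i = j then \<Sum>k\<in>A. s i * s k else 0) + 2 * (\<Sum>i\<in>A. \<Sum>j\<in>A. s i * s j)"
    using assms by (auto intro!: sum.cong)
  also have "(\<Sum>i\<in>A. \<Sum>j\<in>A. if i = j then \<Sum>k\<in>A. s i * s k else 0) = (\<Sum>i\<in>A. \<Sum>k\<in>A. s i * s k)"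
    using assms by simp
  finally show ?thesis
    by (simp add: power2_eq_square sum_product)
qed

lemma power4_sum:
  fixes a :: "'a \<Rightarrow> real"
  shows "(\<Sum>i\<in>A. a i) ^ 4 = (\<Sum>i\<in>A. \<Sum>j\<in>A. \<Sum>k\<in>A. \<Sum>l\<in>A. a i * a j * a k * a l)"
proof -
  have "(\<Sum>i\<in>A. \<Sum>j\<in>A. \<Sum>k\<in>A. \<Sum>l\<in>A. a i * a j * a k * a l) =
      (\<Sum>i\<in>A. a i) * (\<Sum>i\<in>A. a i) * (\<Sum>i\<in>A. a i) * (\<Sum>i\<in>A. a i)"
    by (simp only: sum_distrib_left[symmetric] sum_distrib_right[symmetric])
  then show ?thesis
    by (simp add: power4_eq_xxxx)
qed

text \<open>\<open>G_0\<close> encodes that the sum is centred, since components of positive order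
  have mean 0 anyway. It also makes order 0 harmless wherever one divides by the order.\<close>

locale nonneg_mixed_moments =
  fixes n d :: nat and G :: "nat \<Rightarrow> (nat \<Rightarrow> real) \<Rightarrow> real"
  assumes chaos: "\<And>m. chaos n m (G m)"
    and G_0: "G 0 = (\<lambda>x. 0)"
    and variance: "gauss_mean n (\<lambda>x. (\<Sum>m\<le>d. G m x)\<^sup>2) = 1"
    and mixed3: "\<And>i j. i \<le> d \<Longrightarrow> j \<le> d \<Longrightarrow> i \<noteq> j \<Longrightarrow> gauss_mean n (\<lambda>x. G i x * G j x ^ 3) \<ge> 0"
    and mixed2: "\<And>i j k. i \<le> d \<Longrightarrow> j \<le> d \<Longrightarrow> k \<le> d \<Longrightarrow> distinct [i, j, k] \<Longrightarrow>
      gauss_mean n (\<lambda>x. G i x * G j x * (G k x)\<^sup>2) \<ge> 0"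
    and mixed1: "\<And>i j k l. i \<le> d \<Longrightarrow> j \<le> d \<Longrightarrow> k \<le> d \<Longrightarrow> l \<le> d \<Longrightarrow> distinct [i, j, k, l] \<Longrightarrow>
      gauss_mean n (\<lambda>x. G i x * G j x * G k x * G l x) \<ge> 0"
begin

definition F :: "(nat \<Rightarrow> real) \<Rightarrow> real" where "F x = (\<Sum>m\<le>d. G m x)"

definition s :: "nat \<Rightarrow> real" where "s m = gauss_mean n (\<lambda>x. (G m x)\<^sup>2)"

definition moment4 :: "nat \<Rightarrow> nat \<Rightarrow> nat \<Rightarrow> nat \<Rightarrow> real" where
  "moment4 i j k l = gauss_mean n (\<lambda>x. G i x * G j x * G k x * G l x)"

definition \<kappa> :: real where "\<kappa> = gauss_mean n (\<lambda>x. F x ^ 4) - 3"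

lemma poly_fun_G [simp]: "poly_fun n (G m)"
  using chaos by (rule chaos_poly_fun)

lemma poly_fun_F [simp]: "poly_fun n F"
  unfolding F_def[abs_def] by simp

lemma s_nonneg: "0 \<le> s m"
  unfolding s_def by (intro gauss_mean_nonneg) simp

lemma fourth_cumulant_bound:
  "3 * gauss_mean n (\<lambda>x. (\<Gamma> n (G m) (G m) x - m * s m)\<^sup>2)
    \<le> (real m)\<^sup>2 * (moment4 m m m m - 3 * (s m)\<^sup>2)"
  using chaos_fourth_moment[OF chaos[of m]] by (simp add: s_def moment4_def power4_eq_xxxx)

text \<open>The left side of \<open>fourth_cumulant_bound\<close> is nonnegative, and its right side
  carries the factor m^2, which is divided out. Order 0 is covered by \<open>G_0\<close>.\<close>

lemma fourth_cumulant_nonneg: "3 * (s m)\<^sup>2 \<le> moment4 m m m m"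
proof (cases "m = 0")
  case True
  then show ?thesis
    by (simp add: s_def moment4_def G_0)
next
  case False
  have "0 \<le> 3 * gauss_mean n (\<lambda>x. (\<Gamma> n (G m) (G m) x - m * s m)\<^sup>2)"
    by (intro mult_nonneg_nonneg gauss_mean_nonneg) simp_all
  then have "0 \<le> (real m)\<^sup>2 * (moment4 m m m m - 3 * (s m)\<^sup>2)"
    using fourth_cumulant_bound[of m] by linarith
  then show ?thesis
    using False by (simp add: zero_le_mult_iff)
qed

text \<open>The equality pattern of the indices decides the reason:
  \<open>fourth_cumulant_nonneg\<close> if all agree, \<open>chaos_sq_mult_sq_ge\<close> for two
  distinct pairs. In the other patterns the pairing sum is 0 and one of the sign conditions
  applies.\<close>

lemma pairing_sum_le_moment4:
  assumes "i \<le> d" "j \<le> d" "k \<le> d" "l \<le> d"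
  shows "pairing_sum s i j k l \<le> moment4 i j k l"
proof -
  have A: "0 \<le> moment4 a b b b" if "a \<le> d" "b \<le> d" "a \<noteq> b" for a b
    using mixed3[OF that] by (simp add: moment4_def power3_eq_cube mult_ac)
  have B: "0 \<le> moment4 a b c c" if "a \<le> d" "b \<le> d" "c \<le> d" "distinct [a, b, c]" for a b c
    using mixed2[OF that] by (simp add: moment4_def power2_eq_square mult_ac)
  have C: "0 \<le> moment4 i j k l" if "distinct [i, j, k, l]"
    using mixed1[OF assms that] by (simp add: moment4_def)
  have D: "s a * s b \<le> moment4 a a b b" for a b
    using chaos_sq_mult_sq_ge[OF chaos[of a] chaos[of b]]
    by (simp add: s_def moment4_def power2_eq_square mult_ac)
  \<comment> \<open>The 15 cases are the partitions of four positions: 1 of type 4, then 4 of type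
    3+1, 3 of type 2+2, 6 of type 2+1+1 and 1 of type 1+1+1+1.\<close>
  consider "i = j" "j = k" "k = l"
    | "i = j" "j = k" "k \<noteq> l" | "i = j" "j = l" "k \<noteq> l" | "i = k" "k = l" "j \<noteq> l" | "j = k" "k
      = l" "i \<noteq> j"
    | "i = j" "k = l" "j \<noteq> k" | "i = k" "j = l" "j \<noteq> k" | "i = l" "j = k" "i \<noteq> j"
    | "i = j" "distinct [i, k, l]" | "i = k" "distinct [i, j, l]" | "i = l" "distinct [i, j, k]"
    | "j = k" "distinct [i, j, l]" | "j = l" "distinct [i, j, k]" | "k = l" "distinct [i, j, k]"
    | "distinct [i, j, k, l]"
    unfolding distinct.simps list.set by (smt (verit) empty_iff insert_iff)
  then show ?thesis
  proof cases
    case 1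
    then show ?thesis
      using fourth_cumulant_nonneg[of i] by (simp add: pairing_sum_def power2_eq_square)
  next
    case 2
    then have "moment4 i j k l = moment4 l i i i"
      by (simp add: moment4_def mult_ac)
    then show ?thesis
      using A[of l i] 2 assms by (simp add: pairing_sum_def)
  next
    case 3
    then have "moment4 i j k l = moment4 k i i i"
      by (simp add: moment4_def mult_ac)
    then show ?thesis
      using A[of k i] 3 assms by (simp add: pairing_sum_def)
  next
    case 4
    then have "moment4 i j k l = moment4 j i i i"
      by (simp add: moment4_def mult_ac)
    then show ?thesis
      using A[of j i] 4 assms by (simp add: pairing_sum_def)
  next
    case 5
    then show ?thesis
      using A[of i j] assms by (simp add: pairing_sum_def)
  next
    case 6
    then show ?thesis
      using D[of i k] by (simp add: pairing_sum_def)
  next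
    case 7
    then have "moment4 i j k l = moment4 i i j j"
      by (simp add: moment4_def mult_ac)
    then show ?thesis
      using D[of i j] 7 by (simp add: pairing_sum_def)
  next
    case 8
    then have "moment4 i j k l = moment4 i i j j"
      by (simp add: moment4_def mult_ac)
    then show ?thesis
      using D[of i j] 8 by (simp add: pairing_sum_def)
  next
    case 9
    then have "moment4 i j k l = moment4 k l i i"
      by (simp add: moment4_def mult_ac)
    then show ?thesis
      using B[of k l i] 9 assms by (auto simp: pairing_sum_def)
  next
    case 10
    then have "moment4 i j k l = moment4 j l i i"
      by (simp add: moment4_def mult_ac)
    then show ?thesis
      using B[of j l i] 10 assms by (auto simp: pairing_sum_def)
  next
    case 11
    then have "moment4 i j k l = moment4 j k i i"
      by (simp add: moment4_def mult_ac)
    then show ?thesis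
      using B[of j k i] 11 assms by (auto simp: pairing_sum_def)
  next
    case 12
    then have "moment4 i j k l = moment4 i l j j"
      by (simp add: moment4_def mult_ac)
    then show ?thesis
      using B[of i l j] 12 assms by (auto simp: pairing_sum_def)
  next
    case 13
    then have "moment4 i j k l = moment4 i k j j"
      by (simp add: moment4_def mult_ac)
    then show ?thesis
      using B[of i k j] 13 assms by (auto simp: pairing_sum_def)
  next
    case 14
    then show ?thesis
      using B[of i j k] assms by (auto simp: pairing_sum_def)
  next
    case 15
    then show ?thesis
      using C by (auto simp: pairing_sum_def)
  qed
qed

lemma sum_s: "(\<Sum>m\<le>d. s m) = 1"
proof -
  have "1 = gauss_mean n (\<lambda>x. \<Sum>i\<le>d. \<Sum>j\<le>d. G i x * G j x)"
    using variance by (simp add: power2_eq_square sum_product)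
  also have "\<dots> = (\<Sum>i\<le>d. \<Sum>j\<le>d. if i = j then s i else 0)"
  proof -
    have "gauss_mean n (\<lambda>x. G i x * G j x) = (if i = j then s i else 0)" for i j
      using chaos_orthogonal[OF chaos[of i] chaos[of j]] by (simp add: s_def power2_eq_square)
    then show ?thesis
      by simp
  qed
  finally show ?thesis
    by simp
qed

lemma s_le_1: "m \<le> d \<Longrightarrow> s m \<le> 1"
  using sum_s member_le_sum[of m "{..d}" s] s_nonneg by simp

text \<open>\<open>\<kappa>\<close> is the sum of these differences over all quadruples, the pairing
  sums adding up to 3 because the variances add up to 1. All terms are nonnegative, so each one is
  at most the sum.\<close>

lemma excess_le_\<kappa>:
  assumes "i \<le> d" "j \<le> d" "k \<le> d" "l \<le> d"
  shows "moment4 i j k l - pairing_sum s i j k l \<le> \<kappa>"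
proof -
  let ?e = "\<lambda>i j k l. moment4 i j k l - pairing_sum s i j k l"
  have nn: "0 \<le> ?e i j k l" if "i \<le> d" "j \<le> d" "k \<le> d" "l \<le> d" for i j k l
    using pairing_sum_le_moment4[OF that] by simp
  have "gauss_mean n (\<lambda>x. F x ^ 4) = (\<Sum>i\<le>d. \<Sum>j\<le>d. \<Sum>k\<le>d. \<Sum>l\<le>d. moment4 i j k l)"
    unfolding F_def power4_sum by (simp add: moment4_def)
  then have "\<kappa> = (\<Sum>i\<le>d. \<Sum>j\<le>d. \<Sum>k\<le>d. \<Sum>l\<le>d. ?e i j k l)"
    by (simp add: \<kappa>_def sum_subtractf sum_pairing_sum sum_s)
  also have "\<dots> \<ge> (\<Sum>j\<le>d. \<Sum>k\<le>d. \<Sum>l\<le>d. ?e i j k l)"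
    using assms nn
    by (intro member_le_sum[of i "{..d}" "\<lambda>i. \<Sum>j\<le>d. \<Sum>k\<le>d. \<Sum>l\<le>d. ?e i j k l"] sum_nonneg) auto
  also have "(\<Sum>j\<le>d. \<Sum>k\<le>d. \<Sum>l\<le>d. ?e i j k l) \<ge> (\<Sum>k\<le>d. \<Sum>l\<le>d. ?e i j k l)"
    using assms nn by (intro member_le_sum[of j "{..d}" "\<lambda>j. \<Sum>k\<le>d. \<Sum>l\<le>d. ?e i j k l"] sum_nonneg)
      auto
  also have "(\<Sum>k\<le>d. \<Sum>l\<le>d. ?e i j k l) \<ge> (\<Sum>l\<le>d. ?e i j k l)"
    using assms nn by (intro member_le_sum[of k "{..d}" "\<lambda>k. \<Sum>l\<le>d. ?e i j k l"] sum_nonneg) auto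
  also have "(\<Sum>l\<le>d. ?e i j k l) \<ge> ?e i j k l"
    using assms nn by (intro member_le_sum[of l "{..d}" "\<lambda>l. ?e i j k l"] sum_nonneg) auto
  finally show ?thesis .
qed

lemma \<kappa>_nonneg: "0 \<le> \<kappa>"
  using excess_le_\<kappa>[of 0 0 0 0] pairing_sum_le_moment4[of 0 0 0 0] by linarith

text \<open>On the diagonal the fourth cumulant suffices. Off the diagonal
  \<open>\<Gamma>_chaos_sq_le\<close> reduces the claim to \<open>X\<close>, which consists of a
  covariance of order \<kappa> and a correlation with the fluctuation \<open>?V\<close>.
  Cauchy-Schwarz bounds the latter only to order \<open>sqrt \<kappa>\<close>, which is the source
  of the fourth root in the theorem.\<close>

lemma \<Gamma>_G_mean_sq:
  assumes "p \<le> d" "q \<le> d"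
  shows "gauss_mean n (\<lambda>x. (\<Gamma> n (G p) (G q) x - (if p = q then p * s p else 0))\<^sup>2)
    \<le> (real d)\<^sup>2 * (\<kappa> + sqrt \<kappa>)"
proof -
  have diag: "3 * gauss_mean n (\<lambda>x. (\<Gamma> n (G m) (G m) x - m * s m)\<^sup>2) \<le> (real d)\<^sup>2 * \<kappa>" if "m
    \<le> d" for m
  proof -
    have "moment4 m m m m - 3 * (s m)\<^sup>2 \<le> \<kappa>"
      using excess_le_\<kappa>[of m m m m] that by (simp add: pairing_sum_def power2_eq_square)
    then have "(real m)\<^sup>2 * (moment4 m m m m - 3 * (s m)\<^sup>2) \<le> (real d)\<^sup>2 * \<kappa>"
      using that \<kappa>_nonneg fourth_cumulant_nonneg[of m]
      by (intro mult_mono) (auto simp: power_mono)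
    then show ?thesis
      using fourth_cumulant_bound[of m] by linarith
  qed
  show ?thesis
  proof (cases "p = q")
    case True
    have "(real d)\<^sup>2 * \<kappa> \<le> (real d)\<^sup>2 * (\<kappa> + sqrt \<kappa>)"
      using \<kappa>_nonneg by (intro mult_left_mono) auto
    moreover have "0 \<le> (real d)\<^sup>2 * \<kappa>"
      using \<kappa>_nonneg by simp
    ultimately show ?thesis
      using diag[OF assms(1)] True by simp
  next
    case False
    let ?V = "\<lambda>x. \<Gamma> n (G p) (G p) x - p * s p"
    define X where "X = gauss_mean n (\<lambda>x. G p x * G q x * \<Gamma> n (G p) (G q) x)"
    \<comment> \<open>Centring the carre du champ at \<open>p * s p\<close> splits off
      \<open>p * s p * s q\<close>, which turns the mixed moment into a covariance of
      squares.\<close>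
    have "2 * X = p * (moment4 p p q q - s p * s q) - gauss_mean n (\<lambda>x. (G q x)\<^sup>2 * ?V x)"
    proof -
      have "gauss_mean n (\<lambda>x. (G q x)\<^sup>2 * ?V x)
        = gauss_mean n (\<lambda>x. (G q x)\<^sup>2 * \<Gamma> n (G p) (G p) x - p * s p * (G q x)\<^sup>2)"
        by (intro Bochner_Integration.integral_cong) (simp_all add: algebra_simps)
      then have "gauss_mean n (\<lambda>x. (G q x)\<^sup>2 * ?V x)
        = gauss_mean n (\<lambda>x. (G q x)\<^sup>2 * \<Gamma> n (G p) (G p) x) - p * s p * s q"
        by (simp add: s_def)
      moreover have "moment4 p p q q = gauss_mean n (\<lambda>x. (G p x)\<^sup>2 * (G q x)\<^sup>2)"
        by (simp add: moment4_def power2_eq_square mult_ac)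
      ultimately show ?thesis
        using chaos_cross_identity[OF chaos[of p] poly_fun_G[of q]]
        by (simp add: X_def right_diff_distrib)
    qed
    also have "\<dots> \<le> d * \<kappa> + (\<kappa> + 2 * sqrt \<kappa>) * d"
    proof -
      have "moment4 p p q q - s p * s q \<le> \<kappa>" "0 \<le> moment4 p p q q - s p * s q"
        using excess_le_\<kappa>[of p p q q] pairing_sum_le_moment4[of p p q q] assms False
        by (simp_all add: pairing_sum_def)
      then have 1: "p * (moment4 p p q q - s p * s q) \<le> d * \<kappa>"
        using assms by (intro mult_mono) auto
      have G4: "gauss_mean n (\<lambda>x. ((G q x)\<^sup>2)\<^sup>2) \<le> \<kappa> + 3"
      proof -
        have "(s q)\<^sup>2 \<le> 1"
          using s_le_1[OF assms(2)] s_nonneg[of q] by (simp add: power_le_one)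
        then show ?thesis
          using excess_le_\<kappa>[of q q q q] assms
          by (simp add: pairing_sum_def moment4_def power2_eq_square mult_ac)
      qed
      have "0 \<le> (real d)\<^sup>2 * \<kappa>"
        using \<kappa>_nonneg by simp
      then have V: "gauss_mean n (\<lambda>x. (?V x)\<^sup>2) \<le> (real d)\<^sup>2 * \<kappa>"
        using diag[OF assms(1)] by linarith
      have "- gauss_mean n (\<lambda>x. (G q x)\<^sup>2 * ?V x)
        \<le> sqrt (gauss_mean n (\<lambda>x. ((G q x)\<^sup>2)\<^sup>2)) * sqrt (gauss_mean n (\<lambda>x. (?V x)\<^sup>2))"
        using cauchy_schwarz_gauss_mean[of n "\<lambda>x. (G q x)\<^sup>2" ?V] by simp
      also have "\<dots> \<le> sqrt (\<kappa> + 3) * sqrt ((real d)\<^sup>2 * \<kappa>)"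
        using G4 V by (intro mult_mono real_sqrt_le_mono)
          (auto intro!: real_sqrt_ge_zero gauss_mean_nonneg simp: \<kappa>_nonneg)
      also have "\<dots> = sqrt ((\<kappa> + 3) * \<kappa>) * d"
        by (simp add: real_sqrt_mult)
      also have "\<dots> \<le> (\<kappa> + 2 * sqrt \<kappa>) * d"
      proof (intro mult_right_mono)
        \<comment> \<open>The factor 2 leaves room: the right side is at least \<kappa>^2 + 4
          \<kappa>.\<close>
        have "(\<kappa> + 3) * \<kappa> \<le> (\<kappa> + 2 * sqrt \<kappa>)\<^sup>2"
          using \<kappa>_nonneg
          by (simp add: power2_sum power_mult_distrib algebra_simps power2_eq_square[of \<kappa>])
        then show "sqrt ((\<kappa> + 3) * \<kappa>) \<le> \<kappa> + 2 * sqrt \<kappa>"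
          using \<kappa>_nonneg by (intro real_le_lsqrt) auto
      qed simp
      finally show ?thesis
        using 1 by simp
    qed
    finally have X: "X \<le> d * (\<kappa> + sqrt \<kappa>)"
      by (simp add: algebra_simps)
    have "2 * gauss_mean n (\<lambda>x. (\<Gamma> n (G p) (G q) x)\<^sup>2) \<le> real (p + q) * X"
      unfolding X_def by (intro \<Gamma>_chaos_sq_le chaos)
    also have "\<dots> \<le> real (p + q) * (d * (\<kappa> + sqrt \<kappa>))"
      using X by (intro mult_left_mono) auto
    also have "\<dots> \<le> real (2 * d) * (d * (\<kappa> + sqrt \<kappa>))"
      using assms \<kappa>_nonneg by (intro mult_right_mono) auto
    finally show ?thesis
      using False by (simp add: power2_eq_square[of "real d"] algebra_simps)
  qed
qed

text \<open>The Stein factor \<Gamma>(-L^{-1} F, F): inverting -L divides the component of order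
  \<open>p\<close> by \<open>p\<close>. The summands with \<open>p = 0\<close> are 0.\<close>

definition T :: "(nat \<Rightarrow> real) \<Rightarrow> real" where
  "T x = (\<Sum>p\<le>d. \<Sum>q\<le>d. \<Gamma> n (G p) (G q) x / p)"

text \<open>\<open>T - 1\<close> is a sum of (d + 1)^2 terms, each with L^1 norm at most its L^2
  norm, which \<open>\<Gamma>_G_mean_sq\<close> controls. Then d (d + 1)^2 is rounded up to (d +
  1)^3, and subadditivity of the square root separates \<kappa> from
  \<open>sqrt \<kappa>\<close>.\<close>

lemma mean_abs_T_le: "gauss_mean n (\<lambda>x. \<bar>T x - 1\<bar>) \<le> (d + 1)^3 * (sqrt \<kappa> + root 4 \<kappa>)"
proof -
  let ?V = "\<lambda>p q x. \<Gamma> n (G p) (G q) x - (if p = q then p * s p else 0)"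
  have T: "T x - 1 = (\<Sum>p\<le>d. \<Sum>q\<le>d. ?V p q x / p)" for x
  proof -
    \<comment> \<open>At \<open>p = 0\<close> the quotient is 0 by convention, in agreement with
      \<open>s 0 = 0\<close>.\<close>
    have "(\<Sum>p\<le>d. \<Sum>q\<le>d. (if p = q then p * s p else 0) / p) = (\<Sum>p\<le>d. s p)"
      using G_0 by (auto intro!: sum.cong simp: if_distrib[of "\<lambda>x. x / _"] s_def cong: if_cong)
    then show ?thesis
      by (simp add: T_def sum_s diff_divide_distrib sum_subtractf)
  qed
  have abs_le: "gauss_mean n (\<lambda>x. \<bar>u x\<bar>) \<le> sqrt (gauss_mean n (\<lambda>x. (u x)\<^sup>2))" if "poly_fun n u"
    for u
  proof -
    interpret prob_space "std_gaussian n"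
      by (rule prob_space_std_gaussian)
    have "(gauss_mean n (\<lambda>x. \<bar>u x\<bar>))\<^sup>2 \<le> gauss_mean n (\<lambda>x. \<bar>u x\<bar>\<^sup>2)"
      using that variance_positive[of "\<lambda>x. \<bar>u x\<bar>"] by (subst (asm) variance_eq) auto
    then show ?thesis
      by (intro real_le_rsqrt) simp
  qed
  have "gauss_mean n (\<lambda>x. \<bar>T x - 1\<bar>) \<le> gauss_mean n (\<lambda>x. \<Sum>p\<le>d. \<Sum>q\<le>d. \<bar>?V p q x / p\<bar>)"
    unfolding T
    by (intro integral_mono integrable_abs Bochner_Integration.integrable_sum integrable_poly_fun
      order_trans[OF sum_abs] sum_mono) auto
  also have "\<dots> = (\<Sum>p\<le>d. \<Sum>q\<le>d. gauss_mean n (\<lambda>x. \<bar>?V p q x / p\<bar>))"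
    by (simp add: integrable_abs)
  also have "\<dots> \<le> (\<Sum>p\<le>d. \<Sum>q\<le>d. d * sqrt (\<kappa> + sqrt \<kappa>))"
  proof (intro sum_mono)
    fix p q assume "p \<in> {..d}" "q \<in> {..d}"
    then have "sqrt (gauss_mean n (\<lambda>x. (?V p q x)\<^sup>2)) \<le> sqrt ((real d)\<^sup>2 * (\<kappa> + sqrt \<kappa>))"
      by (intro real_sqrt_le_mono \<Gamma>_G_mean_sq) auto
    also have "\<dots> = d * sqrt (\<kappa> + sqrt \<kappa>)"
      by (simp add: real_sqrt_mult)
    finally have "sqrt (gauss_mean n (\<lambda>x. (?V p q x)\<^sup>2)) \<le> d * sqrt (\<kappa> + sqrt \<kappa>)" .
    moreover have "gauss_mean n (\<lambda>x. \<bar>?V p q x\<bar>) \<le> sqrt (gauss_mean n (\<lambda>x. (?V p q x)\<^sup>2))"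
      by (intro abs_le poly_fun_diff poly_fun_\<Gamma> poly_fun_G poly_fun_simps)
    moreover have "gauss_mean n (\<lambda>x. \<bar>?V p q x / p\<bar>) \<le> gauss_mean n (\<lambda>x. \<bar>?V p q x\<bar>)"
      by (intro integral_mono integrable_abs integrable_poly_fun)
        (auto simp: abs_divide divide_le_eq mult_le_cancel_left1)
    ultimately show "gauss_mean n (\<lambda>x. \<bar>?V p q x / p\<bar>) \<le> d * sqrt (\<kappa> + sqrt \<kappa>)"
      by linarith
  qed
  also have "\<dots> = d * (d + 1)\<^sup>2 * sqrt (\<kappa> + sqrt \<kappa>)"
    by (simp add: power2_eq_square algebra_simps)
  also have "\<dots> \<le> (d + 1)^3 * (sqrt \<kappa> + root 4 \<kappa>)"
  proof (intro mult_mono)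
    have "root 4 \<kappa> = sqrt (sqrt \<kappa>)"
      using real_root_mult_exp[of 2 2 \<kappa>] by (simp add: sqrt_def)
    then show "sqrt (\<kappa> + sqrt \<kappa>) \<le> sqrt \<kappa> + root 4 \<kappa>"
      using sqrt_add_le_add_sqrt[of \<kappa> "sqrt \<kappa>"] \<kappa>_nonneg by simp
  qed (auto simp: power3_eq_cube power2_eq_square \<kappa>_nonneg algebra_simps)
  finally show ?thesis .
qed

end

section \<open>Stein's equation\<close>

lemma integrable_poly_density: "integrable lborel (\<lambda>y. poly p y * std_normal_density y)"
proof -
  have "poly p \<in> borel_measurable borel"
    by (intro borel_measurable_continuous_onI continuous_intros)
  then show ?thesis
    using integrable_poly_gauss[of p] by (subst (asm) integrable_density) (auto simp: mult_ac)
qed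

text \<open>The integrand is the derivative of minus \<open>p\<close> times the density. The
  polynomial 1 gives the tail formula for the density, and other choices of \<open>p\<close> give
  majorants whose integrals are explicit.\<close>

lemma gauss_tail_integral:
  "(\<integral>y. indicator {x<..} y * ((y * poly p y - poly (pderiv p) y) * std_normal_density y) \<partial>lborel)
    = poly p x * std_normal_density x"
proof -
  have "(LBINT y=ereal x..\<infinity>. (y * poly p y - poly (pderiv p) y) * std_normal_density y)
    = 0 - (- (poly p x * std_normal_density x))"
  proof (rule interval_integral_FTC_integrable)
    show "((\<lambda>y. - (poly p y * std_normal_density y)) has_vector_derivative
      (y * poly p y - poly (pderiv p) y) * std_normal_density y) (at y)" for y
      unfolding has_real_derivative_iff_has_vector_derivative[symmetric]
      by (auto intro!: derivative_eq_intros poly_DERIV std_normal_density_deriv simp: algebra_simps)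
    have q: "isCont std_normal_density y" for y
      using std_normal_density_deriv by (rule DERIV_isCont)
    then show "isCont (\<lambda>y. (y * poly p y - poly (pderiv p) y) * std_normal_density y) y" for y
      by (intro continuous_intros)
    have "integrable lborel (\<lambda>y. poly ([:0, 1:] * p - pderiv p) y * std_normal_density y)"
      by (rule integrable_poly_density)
    then show "set_integrable lborel (einterval (ereal x) \<infinity>)
      (\<lambda>y. (y * poly p y - poly (pderiv p) y) * std_normal_density y)"
      unfolding set_integrable_def by (intro integrable_mult_indicator) simp_all
    have "((\<lambda>y. - (poly p y * std_normal_density y)) \<longlongrightarrow> - (poly p x * std_normal_density x)) (at x)"
      using q by (intro tendsto_intros) (simp_all add: isCont_def)
    then show "(((\<lambda>y. - (poly p y * std_normal_density y)) \<circ> real_of_ereal) \<longlongrightarrow>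
      - (poly p x * std_normal_density x)) (at_right (ereal x))"
      unfolding ereal_tendsto_simps by (rule filterlim_mono) (auto simp: at_le)
    show "(((\<lambda>y. - (poly p y * std_normal_density y)) \<circ> real_of_ereal) \<longlongrightarrow> 0) (at_left \<infinity>)"
      unfolding ereal_tendsto_simps
      using tendsto_minus[OF poly_times_density_tendsto[of at_top p]] by simp
  qed simp
  then show ?thesis
    by (simp add: interval_lebesgue_integral_def set_lebesgue_integral_def)
qed

locale lipschitz_fun =
  fixes \<phi> :: "real \<Rightarrow> real"
  assumes lip: "\<And>x y. \<bar>\<phi> x - \<phi> y\<bar> \<le> \<bar>x - y\<bar>"
begin

lemma cont: "continuous_on A \<phi>"
proof -
  have "1-lipschitz_on A \<phi>"
    by (rule lipschitz_onI) (use lip in \<open>auto simp: dist_real_def\<close>)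
  then show ?thesis
    by (rule lipschitz_on_continuous_on)
qed

lemma meas [measurable]: "\<phi> \<in> borel_measurable borel"
  by (intro borel_measurable_continuous_onI cont)

lemma integrable_lip:
  assumes "prob_space M" "sets M = sets borel" "integrable M (\<lambda>x. x)"
  shows "integrable M \<phi>"
proof -
  interpret prob_space M by fact
  have "integrable M (\<lambda>x. \<bar>\<phi> 0\<bar> + \<bar>x\<bar>)"
    using assms by (intro Bochner_Integration.integrable_add integrable_abs) auto
  then show ?thesis
  proof (rule Bochner_Integration.integrable_bound)
    have "\<bar>\<phi> x\<bar> \<le> \<bar>\<phi> 0\<bar> + \<bar>x\<bar>" for x
      using lip[of x 0] by simp
    then show "AE x in M. norm (\<phi> x) \<le> norm (\<bar>\<phi> 0\<bar> + \<bar>x\<bar>)"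
      by simp
  qed (use meas assms(2) in \<open>simp cong: measurable_cong_sets\<close>)
qed

definition c :: real where "c = (\<integral>x. \<phi> x \<partial>std_normal_distribution)"

definition g :: "real \<Rightarrow> real" where "g y = (\<phi> y - c) * std_normal_density y"

text \<open>Up to sign and division by the density, this is the solution of Stein's equation for
  \<phi>; see \<open>stein_solution\<close>.\<close>

definition U :: "real \<Rightarrow> real" where "U x = (\<integral>y. indicator {x<..} y * g y \<partial>lborel)"

lemma integrable_\<phi>: "integrable std_normal_distribution \<phi>"
  using integrable_std_normal_distribution_moment[of 1]
  by (intro integrable_lip prob_space_gauss) simp_all

lemma cont_g: "continuous_on A g"
proof -
  have "continuous_on A std_normal_density"
    using std_normal_density_deriv by (meson DERIV_isCont continuous_at_imp_continuous_on)
  then show ?thesis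
    unfolding g_def[abs_def] by (intro continuous_intros cont)
qed

lemma meas_g [measurable]: "g \<in> borel_measurable borel"
  unfolding g_def[abs_def] by measurable

lemma integrable_g: "integrable lborel g"
  and integral_g: "(\<integral>y. g y \<partial>lborel) = 0"
proof -
  interpret prob_space std_normal_distribution
    by (rule prob_space_gauss)
  have i: "integrable std_normal_distribution (\<lambda>y. \<phi> y - c)"
    using integrable_\<phi> by simp
  then show "integrable lborel g"
    unfolding g_def[abs_def] by (subst (asm) integrable_density) (auto simp: mult_ac)
  have "(\<integral>y. \<phi> y - c \<partial>std_normal_distribution) = 0"
    using integrable_\<phi> prob_space by (simp add: c_def)
  then show "(\<integral>y. g y \<partial>lborel) = 0"
    unfolding g_def[abs_def] by (subst (asm) integral_density) (auto simp: mult_ac)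
qed

lemma integrable_indicator_g: "A \<in> sets borel \<Longrightarrow> integrable lborel (\<lambda>y. indicator A y * g y)"
  using integrable_mult_indicator[OF _ integrable_g, of A] by simp

lemma U_deriv: "(U has_real_derivative - g x) (at x)"
proof -
  define a where "a = x - 1"
  \<comment> \<open>Near \<open>x\<close> the tail integral is a constant minus an integral over a
    bounded interval, to which the fundamental theorem applies. The endpoint \<open>a\<close> is a
    null set.\<close>
  have U: "U t = U a - integral {a..t} g" if "t \<in> {a<..<x + 1}" for t
  proof -
    have "U a = (\<integral>y. indicator {a..t} y * g y + indicator {t<..} y * g y \<partial>lborel)"
      unfolding U_def using that AE_lborel_singleton[of a]
      by (intro integral_cong_AE) (auto elim!: eventually_mono simp: indicator_def)
    also have "\<dots> = (\<integral>y. indicator {a..t} y * g y \<partial>lborel) + U t"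
      unfolding U_def by (intro Bochner_Integration.integral_add integrable_indicator_g) auto
    also have "(\<integral>y. indicator {a..t} y * g y \<partial>lborel) = integral {a..t} g"
      using set_borel_integral_eq_integral(2)[of "{a..t}" g] integrable_indicator_g[of "{a..t}"]
      by (simp add: set_integrable_def set_lebesgue_integral_def)
    finally show ?thesis
      by simp
  qed
  have "((\<lambda>t. integral {a..t} g) has_real_derivative g x) (at x within {a..x+1})"
    by (rule integral_has_real_derivative) (auto simp: a_def cont_g)
  then have "((\<lambda>t. integral {a..t} g) has_real_derivative g x) (at x within {a<..<x+1})"
    by (rule DERIV_subset) auto
  then have "((\<lambda>t. integral {a..t} g) has_real_derivative g x) (at x)"
    by (subst (asm) at_within_open) (auto simp: a_def)
  then have "((\<lambda>t. U a - integral {a..t} g) has_real_derivative - g x) (at x)"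
    by (auto intro!: derivative_eq_intros)
  then show ?thesis
    by (rule has_field_derivative_transform_within_open[where S = "{a<..<x+1}"])
      (auto simp: U a_def)
qed

text \<open>Average the Lipschitz bound over a Gaussian \<open>y\<close>, using that the mean of (1
  + y^2) / 2 is 1.\<close>

lemma abs_\<phi>_minus_c: "\<bar>\<phi> x - c\<bar> \<le> \<bar>x\<bar> + 1"
proof -
  interpret prob_space std_normal_distribution
    by (rule prob_space_gauss)
  have i1: "integrable std_normal_distribution (\<lambda>y. y)"
    and i2: "integrable std_normal_distribution (\<lambda>y. y\<^sup>2)"
    using integrable_std_normal_distribution_moment[of 1]
      integrable_std_normal_distribution_moment[of 2] by simp_all
  have "\<phi> x - c = (\<integral>y. \<phi> x - \<phi> y \<partial>std_normal_distribution)"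
    using integrable_\<phi> prob_space by (simp add: c_def)
  then have "\<bar>\<phi> x - c\<bar> \<le> (\<integral>y. \<bar>\<phi> x - \<phi> y\<bar> \<partial>std_normal_distribution)"
    using integral_abs_bound[of std_normal_distribution "\<lambda>y. \<phi> x - \<phi> y"] by simp
  also have "\<dots> \<le> (\<integral>y. \<bar>x\<bar> + (1 + y\<^sup>2) / 2 \<partial>std_normal_distribution)"
  proof (rule integral_mono)
    show "\<bar>\<phi> x - \<phi> y\<bar> \<le> \<bar>x\<bar> + (1 + y\<^sup>2) / 2" for y
    proof -
      have "0 \<le> (\<bar>y\<bar> - 1)\<^sup>2"
        by simp
      then have "\<bar>y\<bar> \<le> (1 + y\<^sup>2) / 2"
        by (simp add: power2_diff)
      then show ?thesis
        using lip[of x y] by linarith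
    qed
  qed (use i2 integrable_\<phi> in auto)
  also have "\<dots> = \<bar>x\<bar> + 1"
    using i2 std_normal_distribution_even_moments(1)[of 1] prob_space by simp
  finally show ?thesis .
qed

text \<open>
  With the density \<open>q\<close>, the identity \<open>q x = \<integral>\<^sub>x\<^sup>\<infinity> y q y dy\<close> turns the left-hand side into the
  integral of \<open>((y - x) (\<phi> x - c) - x (\<phi> y - \<phi> x)) q y\<close> over \<open>y > x\<close>. The affine function \<open>H\<close>
  is chosen so that the derivative of \<open>- H q\<close> dominates the integrand.
\<close>

lemma stein_bound_nonneg:
  assumes "0 \<le> x"
  shows "\<bar>(\<phi> x - c) * std_normal_density x - x * U x\<bar> \<le> 3 * std_normal_density x"
proof -
  let ?q = std_normal_density
  \<comment> \<open>In \<open>2 * x + 1\<close>, the part \<open>x + 1\<close> comes from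
    \<open>abs_\<phi>_minus_c\<close> and \<open>x\<close> from the Lipschitz bound. For
    \<open>x < 1\<close> this factor is at most 3, so the constant 3 works. For larger
    \<open>x\<close>, slope 2 supplies 2x (y - x) and the remaining 3y - 2 covers y - x.\<close>
  obtain H where H: "poly H x = 3" "\<And>y. x \<le> y \<Longrightarrow> (2 * x + 1) * (y - x)
    \<le> y * poly H y - poly (pderiv H) y"
  proof (cases "x < 1")
    case True
    have "(2 * x + 1) * (y - x) \<le> 3 * y" if "x \<le> y" for y
      using True assms that by (intro mult_mono) auto
    then show ?thesis
      by (intro that[of "[:3:]"]) (auto simp: pderiv_pCons mult.commute)
  next
    case False
    have "(2 * x + 1) * (y - x) \<le> y * (2 * (y - x) + 3) - 2" if "x \<le> y" for y
    proof -
      have "x * (y - x) \<le> y * (y - x)"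
        using that by (intro mult_right_mono) auto
      then show ?thesis
        using False that by (simp add: algebra_simps)
    qed
    then show ?thesis
      by (intro that[of "[:3 - 2 * x, 2:]"]) (auto simp: pderiv_pCons algebra_simps)
  qed
  have i0: "integrable lborel (\<lambda>y. indicator {x<..} y * (poly p y * ?q y))" for p
    using integrable_mult_indicator[OF _ integrable_poly_density[of p], of "{x<..}"] by simp
  have i1: "integrable lborel (\<lambda>y. indicator {x<..} y * (y * ?q y))"
    using i0[of "[:0, 1:]"] by simp
  have iH: "integrable lborel (\<lambda>y. indicator {x<..} y *
    ((y * poly H y - poly (pderiv H) y) * ?q y))"
    using i0[of "[:0, 1:] * H - pderiv H"] by simp
  have iU: "integrable lborel (\<lambda>y. indicator {x<..} y * g y)"
    by (intro integrable_indicator_g) simp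
  have "(\<integral>y. indicator {x<..} y * (y * ?q y) \<partial>lborel) = ?q x"
    using gauss_tail_integral[of x "[:1:]"] by (simp add: pderiv_pCons)
  then have "(\<phi> x - c) * ?q x - x * U x =
      (\<integral>y. (\<phi> x - c) * (indicator {x<..} y * (y * ?q y)) - x * (indicator {x<..} y * g y) \<partial>lborel)"
    using i1 iU by (simp add: U_def)
  then have "\<bar>(\<phi> x - c) * ?q x - x * U x\<bar> =
      \<bar>\<integral>y. (\<phi> x - c) * (indicator {x<..} y * (y * ?q y)) - x * (indicator {x<..} y * g y) \<partial>lborel\<bar>"
    by (rule arg_cong)
  also have "\<dots>
    \<le> (\<integral>y. \<bar>(\<phi> x - c) * (indicator {x<..} y * (y * ?q y))
      - x * (indicator {x<..} y * g y)\<bar> \<partial>lborel)"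
    by (rule integral_abs_bound)
  also have "\<dots> \<le> (\<integral>y. indicator {x<..} y * ((y * poly H y - poly (pderiv H) y) * ?q y) \<partial>lborel)"
  proof (rule integral_mono)
    show "integrable lborel (\<lambda>y. \<bar>(\<phi> x - c) * (indicator {x<..} y * (y * ?q y))
      - x * (indicator {x<..} y * g y)\<bar>)"
      using i1 iU
      by (intro integrable_abs Bochner_Integration.integrable_diff integrable_mult_right)
    fix y
    show "\<bar>(\<phi> x - c) * (indicator {x<..} y * (y * ?q y)) - x * (indicator {x<..} y * g y)\<bar>
        \<le> indicator {x<..} y * ((y * poly H y - poly (pderiv H) y) * ?q y)"
    proof (cases "x < y")
      case True
      have "\<bar>(y - x) * (\<phi> x - c) - x * (\<phi> y - \<phi> x)\<bar> \<le> (y - x) * (x + 1) + x * (y - x)"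
      proof (rule order_trans[OF abs_triangle_ineq4 add_mono])
        show "\<bar>(y - x) * (\<phi> x - c)\<bar> \<le> (y - x) * (x + 1)"
          using abs_\<phi>_minus_c[of x] True assms by (simp add: abs_mult mult_left_mono)
        show "\<bar>x * (\<phi> y - \<phi> x)\<bar> \<le> x * (y - x)"
          using lip[of y x] True assms by (simp add: abs_mult mult_left_mono)
      qed
      also have "\<dots> \<le> y * poly H y - poly (pderiv H) y"
        using H(2)[of y] True by (simp add: algebra_simps)
      finally have "\<bar>(y - x) * (\<phi> x - c) - x * (\<phi> y - \<phi> x)\<bar> * ?q y
        \<le> (y * poly H y - poly (pderiv H) y) * ?q y"
        by (intro mult_right_mono) simp_all
      moreover have "(\<phi> x - c) * (y * ?q y) - x * g y
        = ((y - x) * (\<phi> x - c) - x * (\<phi> y - \<phi> x)) * ?q y"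
        by (simp add: g_def algebra_simps)
      ultimately show ?thesis
        using True by (simp add: abs_mult)
    qed simp
  qed (rule iH)
  also have "\<dots> = 3 * ?q x"
    by (simp add: gauss_tail_integral H(1))
  finally show ?thesis .
qed

lemma reflect: "lipschitz_fun (\<lambda>x. \<phi> (- x))"
proof
  show "\<bar>\<phi> (- x) - \<phi> (- y)\<bar> \<le> \<bar>x - y\<bar>" for x y
    using lip[of "- x" "- y"] by linarith
qed

end

lemma std_normal_density_minus [simp]: "std_normal_density (- x) = std_normal_density x"
  by (simp add: std_normal_density_def)

text \<open>Negative \<open>x\<close> are reflected: the constant \<open>c\<close> is unchanged, and
  \<open>U\<close> changes sign because \<open>g\<close> has total integral 0.\<close>

lemma (in lipschitz_fun) stein_bound:
  "\<bar>(\<phi> x - c) * std_normal_density x - x * U x\<bar> \<le> 3 * std_normal_density x"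
proof (cases "0 \<le> x")
  case True
  then show ?thesis
    by (rule stein_bound_nonneg)
next
  case False
  interpret R: lipschitz_fun "\<lambda>x. \<phi> (- x)"
    by (rule reflect)
  have refl: "(\<integral>y. h (- y) \<partial>lborel) = (\<integral>y. h y \<partial>lborel)" for h :: "real \<Rightarrow> real"
    using lborel_integral_real_affine[of "-1" h 0] by simp
  have c: "R.c = c"
    using refl[of "\<lambda>y. std_normal_density y * \<phi> y"]
    by (simp add: c_def R.c_def integral_density)
  have "R.U (- x) = (\<integral>y. indicator {..<x} (- y) * g (- y) \<partial>lborel)"
    unfolding R.U_def by (intro Bochner_Integration.integral_cong)
      (auto simp: R.g_def g_def c indicator_def)
  also have "\<dots> = (\<integral>y. indicator {..<x} y * g y \<partial>lborel)"
    by (rule refl)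
  also have "\<dots> = (\<integral>y. g y - indicator {x<..} y * g y \<partial>lborel)"
    using AE_lborel_singleton[of x]
    by (intro integral_cong_AE) (auto elim!: eventually_mono simp: indicator_def)
  also have "\<dots> = - U x"
    unfolding U_def using integrable_g integrable_indicator_g[of "{x<..}"] by (simp add: integral_g)
  finally have "R.U (- x) = - U x" .
  then show ?thesis
    using R.stein_bound_nonneg[of "- x"] False by (simp add: c)
qed

lemma (in lipschitz_fun) stein_solution:
  obtains f f' where "\<And>x. (f has_real_derivative f' x) (at x)" "continuous_on UNIV f'"
    "\<And>x. \<bar>f' x\<bar> \<le> 3" "\<And>x. f' x - x * f x = \<phi> x - (\<integral>x. \<phi> x \<partial>std_normal_distribution)"
proof
  define f where "f = (\<lambda>x. - U x / std_normal_density x)"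
  define f' where "f' = (\<lambda>x. \<phi> x - c + x * f x)"
  have pos: "0 < std_normal_density x" for x
    by (rule normal_density_pos) simp
  show deriv: "(f has_real_derivative f' x) (at x)" for x
    unfolding f_def f'_def using pos[of x]
    by (auto intro!: derivative_eq_intros U_deriv std_normal_density_deriv simp: g_def field_simps)
  then have "continuous_on UNIV f"
    by (meson DERIV_isCont continuous_at_imp_continuous_on)
  then show "continuous_on UNIV f'"
    unfolding f'_def by (intro continuous_intros cont)
  show "\<bar>f' x\<bar> \<le> 3" for x
  proof -
    have "f' x = ((\<phi> x - c) * std_normal_density x - x * U x) / std_normal_density x"
      using pos[of x] by (simp add: f'_def f_def field_simps)
    then show ?thesis
      using stein_bound[of x] pos[of x] by (simp add: abs_divide divide_le_eq)
  qed
  show "f' x - x * f x = \<phi> x - (\<integral>x. \<phi> x \<partial>std_normal_distribution)" for x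
    by (simp add: f'_def c_def)
qed

section \<open>Distances between laws on the line\<close>

lemma abs_indicator_lessThan_diff:
  "\<bar>indicator {..<x} t - indicator {..<y} t\<bar> = (indicator {min x y..<max x y} t :: real)"
    for x y t :: real
  by (auto simp: indicator_def)

lemma integral_abs_indicator_lessThan_diff:
  "(\<integral>t. \<bar>indicator {..<x} t - indicator {..<y} t\<bar> \<partial>lborel) = \<bar>x - y\<bar>" for x y :: real
  unfolding abs_indicator_lessThan_diff by (simp add: max_def min_def)

text \<open>Kantorovich duality on the line in explicit form: the quantile coupling is paired with a
  potential whose slope is the sign of the difference of the distribution functions, so that the
  transport cost equals the difference of the two integrals.\<close>

lemma W1_dist_le_lipschitz:
  assumes "real_distribution \<mu>" "real_distribution \<nu>" "integrable \<mu> (\<lambda>x. x)" "integrable \<nu> (\<lambda>x. x)"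
  obtains \<phi> where "lipschitz_fun \<phi>" "W1_dist \<mu> \<nu> \<le> ennreal ((\<integral>x. \<phi> x \<partial>\<mu>) - (\<integral>x. \<phi> x \<partial>\<nu>))"
proof -
  interpret M: cdf_distribution \<mu>
    using assms by (simp add: cdf_distribution_def)
  interpret N: cdf_distribution \<nu>
    using assms by (simp add: cdf_distribution_def)
  define \<Omega> where "\<Omega> = restrict_space lborel {0<..<1::real}"
  \<comment> \<open>The quantile functions of both laws, evaluated at the same uniform
    variable.\<close>
  define X where "X = M.I"
  define Y where "Y = N.I"
  interpret \<Omega>: prob_space \<Omega>
    by (auto simp: \<Omega>_def emeasure_restrict_space space_restrict_space intro!: prob_spaceI)
  have [measurable]: "X \<in> borel_measurable \<Omega>" "Y \<in> borel_measurable \<Omega>"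
    using M.measurable_CI N.measurable_CI
    by (simp_all add: X_def Y_def \<Omega>_def cong: measurable_cong_sets)
  have X: "distr \<Omega> borel X = \<mu>" and Y: "distr \<Omega> borel Y = \<nu>"
    unfolding X_def Y_def \<Omega>_def by (rule M.distr_I_eq_M, rule N.distr_I_eq_M)
  \<comment> \<open>\<open>k x y\<close> is the signed indicator of the interval between
    \<open>x\<close> and \<open>y\<close>, so the \<phi> defined below is the primitive of
    \<open>h\<close> that vanishes at 0.\<close>
  define h where "h = (\<lambda>t. sgn (cdf \<nu> t - cdf \<mu> t))"
  define k where "k = (\<lambda>x y t :: real. indicator {..<x} t - indicator {..<y} t :: real)"
  have [measurable]: "h \<in> borel_measurable borel"
    unfolding h_def by measurable
  have [measurable]: "k x y \<in> borel_measurable borel" for x y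
    unfolding k_def by measurable
  have int_k: "integrable lborel (k x y)" for x y
  proof -
    have "integrable lborel (\<lambda>t. \<bar>k x y t\<bar>)"
      unfolding k_def abs_indicator_lessThan_diff by (simp add: max_def min_def)
    then show ?thesis
      by (simp add: integrable_abs_iff)
  qed
  have abs_hk: "\<bar>h t * k x y t\<bar> \<le> \<bar>k x y t\<bar>" for t x y
    by (simp add: h_def abs_mult abs_sgn_eq)
  have int_hk: "integrable lborel (\<lambda>t. h t * k x y t)" for x y
    by (rule Bochner_Integration.integrable_bound[OF int_k[of x y]]) (use abs_hk in auto)
  define \<phi> where "\<phi> = (\<lambda>x. \<integral>t. h t * k x 0 t \<partial>lborel)"
  have \<phi>_diff: "\<phi> x - \<phi> y = (\<integral>t. h t * k x y t \<partial>lborel)" for x y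
    unfolding \<phi>_def using int_hk
    by (subst Bochner_Integration.integral_diff[symmetric]) (auto simp: k_def algebra_simps)
  interpret lipschitz_fun \<phi>
  proof
    fix x y
    have "\<bar>\<phi> x - \<phi> y\<bar> \<le> (\<integral>t. \<bar>h t * k x y t\<bar> \<partial>lborel)"
      unfolding \<phi>_diff by (rule integral_abs_bound)
    also have "\<dots> \<le> (\<integral>t. \<bar>k x y t\<bar> \<partial>lborel)"
      by (intro integral_mono integrable_abs int_hk int_k abs_hk)
    also have "\<dots> = \<bar>x - y\<bar>"
      unfolding k_def by (rule integral_abs_indicator_lessThan_diff)
    finally show "\<bar>\<phi> x - \<phi> y\<bar> \<le> \<bar>x - y\<bar>" .
  qed
  \<comment> \<open>For fixed \<open>t\<close> the quantile coupling makes \<open>{X \<le> t}\<close> and \<open>{Y \<le> t}\<close> nested, so the slope of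
    \<open>\<phi>\<close> between \<open>X\<close> and \<open>Y\<close> is constantly \<open>1\<close> or constantly \<open>-1\<close>.\<close>
  have coupled: "\<bar>X \<omega> - Y \<omega>\<bar> = \<phi> (X \<omega>) - \<phi> (Y \<omega>)" if "\<omega> \<in> space \<Omega>" for \<omega>
  proof -
    have \<omega>: "0 < \<omega>" "\<omega> < 1"
      using that by (auto simp: \<Omega>_def space_restrict_space)
    have iff: "X \<omega> \<le> t \<longleftrightarrow> \<omega> \<le> cdf \<mu> t" "Y \<omega> \<le> t \<longleftrightarrow> \<omega> \<le> cdf \<nu> t" for t
      unfolding X_def Y_def
      by (rule M.pseudoinverse[OF \<omega>, symmetric], rule N.pseudoinverse[OF \<omega>, symmetric])
    have "h t * k (X \<omega>) (Y \<omega>) t = \<bar>k (X \<omega>) (Y \<omega>) t\<bar>" for t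
    proof -
      have "k (X \<omega>) (Y \<omega>) t = (if \<omega> \<le> cdf \<nu> t then 1 else 0) - (if \<omega> \<le> cdf \<mu> t then 1 else 0)"
        unfolding k_def using iff[of t] by (auto simp: indicator_def not_less not_le)
      then show ?thesis
        by (auto simp: h_def sgn_if)
    qed
    then show ?thesis
      unfolding \<phi>_diff using integral_abs_indicator_lessThan_diff[of "X \<omega>" "Y \<omega>"]
      by (simp add: k_def)
  qed
  have i: "integrable \<mu> \<phi>" "integrable \<nu> \<phi>"
    using assms by (auto intro!: integrable_lip M.prob_space_axioms N.prob_space_axioms)
  then have i': "integrable \<Omega> (\<lambda>\<omega>. \<phi> (X \<omega>))" "integrable \<Omega> (\<lambda>\<omega>. \<phi> (Y \<omega>))"
    using integrable_distr[of X \<Omega> borel \<phi>] integrable_distr[of Y \<Omega> borel \<phi>] by (simp_all add: X Y)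
  define \<pi> where "\<pi> = distr \<Omega> (borel \<Otimes>\<^sub>M borel) (\<lambda>\<omega>. (X \<omega>, Y \<omega>))"
  have "\<pi> \<in> couplings \<mu> \<nu>"
    unfolding couplings_def \<pi>_def using X Y
    by (auto simp: distr_distr comp_def intro!: \<Omega>.prob_space_distr)
  then have "W1_dist \<mu> \<nu> \<le> (\<integral>\<^sup>+ p. ennreal \<bar>fst p - snd p\<bar> \<partial>\<pi>)"
    unfolding W1_dist_def by (rule INF_lower)
  also have "\<dots> = (\<integral>\<^sup>+ \<omega>. ennreal \<bar>X \<omega> - Y \<omega>\<bar> \<partial>\<Omega>)"
    unfolding \<pi>_def by (subst nn_integral_distr) simp_all
  also have "\<dots> = (\<integral>\<^sup>+ \<omega>. ennreal (\<phi> (X \<omega>) - \<phi> (Y \<omega>)) \<partial>\<Omega>)"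
    by (intro nn_integral_cong) (simp add: coupled)
  also have "\<dots> = ennreal (\<integral>\<omega>. \<phi> (X \<omega>) - \<phi> (Y \<omega>) \<partial>\<Omega>)"
    using i' coupled by (intro nn_integral_eq_integral AE_I2) (auto simp flip: coupled)
  also have "(\<integral>\<omega>. \<phi> (X \<omega>) - \<phi> (Y \<omega>) \<partial>\<Omega>) = (\<integral>x. \<phi> x \<partial>\<mu>) - (\<integral>x. \<phi> x \<partial>\<nu>)"
    using i' integral_distr[of X \<Omega> borel \<phi>] integral_distr[of Y \<Omega> borel \<phi>] by (simp add: X Y)
  finally show ?thesis
    using that lipschitz_fun_axioms by blast
qed

text \<open>Test functions are 1-Lipschitz by the mean value inequality, so every coupling bounds
  the difference of their expectations.\<close>

lemma d2_dist_le_W1_dist: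
  assumes "real_distribution \<mu>" "real_distribution \<nu>" "integrable \<mu> (\<lambda>x. x)" "integrable \<nu> (\<lambda>x. x)"
  shows "d2_dist \<mu> \<nu> \<le> W1_dist \<mu> \<nu>"
  unfolding d2_dist_def W1_dist_def
proof (intro SUP_least INF_greatest)
  fix f \<pi> assume f: "f \<in> d2_test_functions" and \<pi>: "\<pi> \<in> couplings \<mu> \<nu>"
  interpret M: real_distribution \<mu> by fact
  interpret N: real_distribution \<nu> by fact
  interpret lipschitz_fun f
  proof
    obtain f' where f': "\<And>x. (f has_real_derivative f' x) (at x)" "\<And>x. \<bar>f' x\<bar> \<le> 1"
      using f unfolding d2_test_functions_def by blast
    show "\<bar>f x - f y\<bar> \<le> \<bar>x - y\<bar>" for x y
      using field_differentiable_bound[of UNIV f f' 1 x y] f' by simp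
  qed
  have i: "integrable \<mu> f" "integrable \<nu> f"
    using assms by (auto intro!: integrable_lip M.prob_space_axioms N.prob_space_axioms)
  interpret P: prob_space \<pi>
    using \<pi> by (simp add: couplings_def)
  have [measurable_cong]: "sets \<pi> = sets (borel \<Otimes>\<^sub>M borel)"
    and d: "distr \<pi> borel fst = \<mu>" "distr \<pi> borel snd = \<nu>"
    using \<pi> by (auto simp: couplings_def)
  have i': "integrable \<pi> (\<lambda>p. f (fst p))" "integrable \<pi> (\<lambda>p. f (snd p))"
    using i integrable_distr[of fst \<pi> borel f] integrable_distr[of snd \<pi> borel f]
    by (simp_all add: d)
  have "(\<integral>x. f x \<partial>\<mu>) - (\<integral>x. f x \<partial>\<nu>) = (\<integral>p. f (fst p) - f (snd p) \<partial>\<pi>)"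
    using i' integral_distr[of fst \<pi> borel f] integral_distr[of snd \<pi> borel f] by (simp add: d)
  then have "\<bar>(\<integral>x. f x \<partial>\<mu>) - (\<integral>x. f x \<partial>\<nu>)\<bar> \<le> (\<integral>p. \<bar>f (fst p) - f (snd p)\<bar> \<partial>\<pi>)"
    using integral_abs_bound[of \<pi> "\<lambda>p. f (fst p) - f (snd p)"] by simp
  then have "ennreal \<bar>(\<integral>x. f x \<partial>\<mu>) - (\<integral>x. f x \<partial>\<nu>)\<bar> \<le> ennreal (\<integral>p. \<bar>f (fst p) - f (snd p)\<bar> \<partial>\<pi>)"
    by (rule ennreal_leI)
  also have "\<dots> = (\<integral>\<^sup>+p. ennreal \<bar>f (fst p) - f (snd p)\<bar> \<partial>\<pi>)"
    using i' by (intro nn_integral_eq_integral[symmetric]) auto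
  also have "\<dots> \<le> (\<integral>\<^sup>+p. ennreal \<bar>fst p - snd p\<bar> \<partial>\<pi>)"
    by (intro nn_integral_mono ennreal_leI lip)
  finally show "ennreal \<bar>(\<integral>x. f x \<partial>\<mu>) - (\<integral>x. f x \<partial>\<nu>)\<bar> \<le> (\<integral>\<^sup>+p. ennreal \<bar>fst p - snd p\<bar> \<partial>\<pi>)" .
qed

section \<open>The normal approximation bound\<close>

text \<open>Write \<open>m * G\<close> as minus the generator of \<open>G\<close> and integrate by
  parts as in \<open>gauss_mean_mult_ou_gen\<close>, now against the non-polynomial
  \<open>f (H x)\<close>; the chain rule brings in \<Gamma>(G, H).\<close>

lemma chaos_stein:
  assumes G: "chaos n m G" and H: "poly_fun n H"
    and f: "\<And>y. (f has_real_derivative f' y) (at y)" and f'_cont: "continuous_on UNIV f'"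
    and f'_le: "\<And>y. \<bar>f' y\<bar> \<le> B"
  shows "m * gauss_mean n (\<lambda>x. G x * f (H x)) = gauss_mean n (\<lambda>x. \<Gamma> n G H x * f' (H x))"
    and "integrable (std_gaussian n) (\<lambda>x. G x * f (H x))"
    and "integrable (std_gaussian n) (\<lambda>x. \<Gamma> n G H x * f' (H x))"
proof -
  have [simp]: "poly_fun n G" "poly_fun n H"
    using G H by auto
  have f_cont: "continuous_on UNIV f"
    using f by (meson DERIV_isCont continuous_at_imp_continuous_on)
  have B: "0 \<le> B"
    using f'_le[of 0] by linarith
  have f_le: "\<bar>f y\<bar> \<le> \<bar>f 0\<bar> + B * (1 + y\<^sup>2)" for y
  proof -
    have "\<bar>f y - f 0\<bar> \<le> B * \<bar>y\<bar>"
      using field_differentiable_bound[of UNIV f f' B y 0] f f'_le by simp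
    also have "\<dots> \<le> B * (1 + y\<^sup>2)"
      using B by (intro mult_left_mono abs_le_one_plus_square)
    finally show ?thesis
      by linarith
  qed
  have meas: "(\<lambda>x. h (H x)) \<in> borel_measurable (std_gaussian n)" if "continuous_on UNIV h"
    for h :: "real \<Rightarrow> real"
    using measurable_compose[OF measurable_poly_fun[OF H]
      borel_measurable_continuous_onI[OF that]] .
  \<comment> \<open>Polynomial majorants: \<open>f\<close> grows at most linearly because its
    derivative is bounded, and 1 + t^2 replaces every absolute value.\<close>
  define W where "W
    = (\<lambda>(u :: (nat \<Rightarrow> real) \<Rightarrow> real) x. (1 + (u x)\<^sup>2) * (\<bar>f 0\<bar> + B * (1 + (H x)\<^sup>2)) :: real)"
  define W' where "W' = (\<lambda>(u :: (nat \<Rightarrow> real) \<Rightarrow> real) x. (1 + (u x)\<^sup>2) * B :: real)"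
  have [simp]: "poly_fun n (W u)" "poly_fun n (W' u)" if "poly_fun n u" for u
    using that by (simp_all add: W_def W'_def)
  have W: "\<bar>u x * f (H x)\<bar> \<le> \<bar>W u x\<bar>" for u x
    unfolding W_def abs_mult using B abs_le_one_plus_square[of "u x"] f_le[of "H x"]
    by (intro mult_mono) (auto intro: order_trans abs_ge_self)
  have W': "\<bar>u x * f' (H x)\<bar> \<le> \<bar>W' u x\<bar>" for u x
    unfolding W'_def abs_mult using B abs_le_one_plus_square[of "u x"] f'_le[of "H x"]
    by (intro mult_mono) (auto intro: order_trans abs_ge_self)
  have int: "integrable (std_gaussian n) (\<lambda>x. u x * f (H x))" if "poly_fun n u" for u
  proof (rule Bochner_Integration.integrable_bound[OF integrable_poly_fun[of n "W u"] _ AE_I2])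
    show "(\<lambda>x. u x * f (H x)) \<in> borel_measurable (std_gaussian n)"
      by (intro borel_measurable_times meas f_cont measurable_poly_fun that)
  qed (use that W in auto)
  have int': "integrable (std_gaussian n) (\<lambda>x. u x * f' (H x))" if "poly_fun n u" for u
  proof (rule Bochner_Integration.integrable_bound[OF integrable_poly_fun[of n "W' u"] _ AE_I2])
    show "(\<lambda>x. u x * f' (H x)) \<in> borel_measurable (std_gaussian n)"
      by (intro borel_measurable_times meas f'_cont measurable_poly_fun that)
  qed (use that W' in auto)
  show "integrable (std_gaussian n) (\<lambda>x. G x * f (H x))"
    "integrable (std_gaussian n) (\<lambda>x. \<Gamma> n G H x * f' (H x))"
    by (simp_all add: int int')
  have ibp: "gauss_mean n (\<lambda>x. x i * (partial i G x * f (H x))) =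
      gauss_mean n (\<lambda>x. partial i (partial i G) x * f (H x))
        + gauss_mean n (\<lambda>x. partial i G x * partial i H x * f' (H x))"
    if i: "i < n" for i
  proof -
    define g' where "g'
      = (\<lambda>x. partial i (partial i G) x * f (H x) + partial i G x * partial i H x * f' (H x))"
    have "gauss_mean n (\<lambda>x. x i * (partial i G x * f (H x))) = gauss_mean n g'"
    proof (rule std_gaussian_ibp[OF i])
      show "integrable (std_gaussian n) (\<lambda>x. x i * (partial i G x * f (H x)))"
        using int[of "\<lambda>x. x i * partial i G x"] i by (simp add: mult.assoc)
      show "integrable (std_gaussian n) g'"
        unfolding g'_def by (intro Bochner_Integration.integrable_add int int') auto
      show "((\<lambda>t. partial i G (x(i := t)) * f (H (x(i := t)))) has_real_derivative g' (x(i := t)))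
        (at t)" for x t
        unfolding g'_def
        by (auto intro!: derivative_eq_intros DERIV_chain2[OF f] partial_DERIV[of n] simp:
          algebra_simps simp del: fun_upd_apply)
      have comp: "continuous_on UNIV (\<lambda>t. h (H (x(i := t))))" if "continuous_on UNIV h"
        for h :: "real \<Rightarrow> real" and x
        using continuous_on_compose2[OF that poly_fun_line_cont[OF H, of UNIV x i]] by simp
      show "continuous_on UNIV (\<lambda>t. g' (x(i := t)))" for x
        unfolding g'_def by (intro continuous_intros comp f_cont f'_cont poly_fun_line_cont[of n])
          auto
      show "\<exists>p. \<forall>t. \<bar>partial i G (x(i := t)) * f (H (x(i := t)))\<bar> \<le> poly p t" for x
      proof -
        obtain p where "\<And>t. \<bar>W (partial i G) (x(i := t))\<bar> \<le> poly p t"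
          using poly_fun_line_bound[of n "W (partial i G)" x i] by auto
        then show ?thesis
          by (intro exI[of _ p] allI order_trans[OF W])
      qed
      show "\<exists>p. \<forall>t. \<bar>g' (x(i := t))\<bar> \<le> poly p t" for x
      proof -
        let ?u = "partial i (partial i G)" and ?v = "\<lambda>x. partial i G x * partial i H x"
        have "poly_fun n (W ?u)" "poly_fun n (W' ?v)"
          by simp_all
        then obtain p q where "\<And>t. \<bar>W ?u (x(i := t))\<bar> \<le> poly p t" "\<And>t. \<bar>W' ?v (x(i := t))\<bar>
          \<le> poly q t"
          using poly_fun_line_bound[of n "W ?u" x i] poly_fun_line_bound[of n "W' ?v" x i] by blast
        then have "\<bar>g' (x(i := t))\<bar> \<le> poly (p + q) t" for t
          unfolding g'_def poly_add
          by (intro order_trans[OF abs_triangle_ineq] add_mono order_trans[OF W] order_trans[OF W'])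
        then show ?thesis
          by blast
      qed
    qed
    also have "\<dots> = gauss_mean n (\<lambda>x. partial i (partial i G) x * f (H x))
      + gauss_mean n (\<lambda>x. partial i G x * partial i H x * f' (H x))"
      unfolding g'_def by (intro Bochner_Integration.integral_add int int') auto
    finally show ?thesis .
  qed
  have ou_gen_G: "m * G x = (\<Sum>i<n. x i * partial i G x - partial i (partial i G) x)" for x
  proof -
    have "ou_gen n G x = - real m * G x"
      using G by (simp add: chaos_def)
    then show ?thesis
      by (simp add: ou_gen_def sum_subtractf)
  qed
  have "m * gauss_mean n (\<lambda>x. G x * f (H x)) = gauss_mean n (\<lambda>x. m * G x * f (H x))"
    by (simp add: mult.assoc)
  also have "\<dots>
    = gauss_mean n (\<lambda>x. \<Sum>i<n. x i * (partial i G x * f (H x))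
      - partial i (partial i G) x * f (H x))"
    unfolding ou_gen_G by (simp add: sum_distrib_right left_diff_distrib mult.assoc)
  also have "\<dots>
    = (\<Sum>i<n. gauss_mean n (\<lambda>x. x i * (partial i G x * f (H x)))
      - gauss_mean n (\<lambda>x. partial i (partial i G) x * f (H x)))"
  proof -
    have 1: "integrable (std_gaussian n) (\<lambda>x. x i * (partial i G x * f (H x)))" if "i < n" for i
      using int[of "\<lambda>x. x i * partial i G x"] that by (simp add: mult.assoc)
    have 2: "integrable (std_gaussian n) (\<lambda>x. partial i (partial i G) x * f (H x))" for i
      by (intro int) simp
    show ?thesis
      using 1 2 by simp
  qed
  also have "\<dots> = (\<Sum>i<n. gauss_mean n (\<lambda>x. partial i G x * partial i H x * f' (H x)))"
    by (simp add: ibp)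
  also have "\<dots> = gauss_mean n (\<lambda>x. \<Sum>i<n. partial i G x * partial i H x * f' (H x))"
    by (intro Bochner_Integration.integral_sum[symmetric] int') simp
  also have "\<dots> = gauss_mean n (\<lambda>x. \<Gamma> n G H x * f' (H x))"
    by (simp add: \<Gamma>_def sum_distrib_right)
  finally show "m * gauss_mean n (\<lambda>x. G x * f (H x)) = gauss_mean n (\<lambda>x. \<Gamma> n G H x * f' (H x))" .
qed

section \<open>Stein's method for the sum of the components\<close>

context nonneg_mixed_moments
begin

lemma poly_fun_T [simp]: "poly_fun n T"
  unfolding T_def[abs_def] by simp

lemma T_eq: "T x = (\<Sum>p\<le>d. \<Gamma> n (G p) F x / p)"
proof -
  have "\<Gamma> n (G p) F x = (\<Sum>q\<le>d. \<Gamma> n (G p) (G q) x)" for p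
    unfolding \<Gamma>_def F_def[abs_def]
    by (subst sum.swap) (simp add: partial_sum[of _ n] sum_distrib_left)
  then show ?thesis
    by (simp add: T_def sum_divide_distrib)
qed

text \<open>Divide \<open>chaos_stein\<close> by the order \<open>p\<close> and sum over
  \<open>p\<close>. Order 0 contributes nothing because \<open>G 0\<close> vanishes.\<close>

lemma stein_identity:
  assumes "\<And>y. (f has_real_derivative f' y) (at y)" "continuous_on UNIV f'" "\<And>y. \<bar>f' y\<bar> \<le> B"
  shows "gauss_mean n (\<lambda>x. F x * f (F x)) = gauss_mean n (\<lambda>x. T x * f' (F x))"
    and "integrable (std_gaussian n) (\<lambda>x. F x * f (F x))"
    and "integrable (std_gaussian n) (\<lambda>x. T x * f' (F x))"
proof -
  note st = chaos_stein[OF chaos poly_fun_F assms]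
  have F: "F x * f (F x) = (\<Sum>p\<le>d. G p x * f (F x))" for x
    by (subst (1) F_def) (simp add: sum_distrib_right)
  have T: "T x * f' (F x) = (\<Sum>p\<le>d. \<Gamma> n (G p) F x * f' (F x) / p)" for x
    by (simp add: T_eq sum_distrib_right)
  show "integrable (std_gaussian n) (\<lambda>x. F x * f (F x))"
    "integrable (std_gaussian n) (\<lambda>x. T x * f' (F x))"
    unfolding F T using st(2,3)
    by (auto intro!: Bochner_Integration.integrable_sum integrable_divide)
  have "gauss_mean n (\<lambda>x. F x * f (F x)) = (\<Sum>p\<le>d. gauss_mean n (\<lambda>x. G p x * f (F x)))"
    unfolding F using st(2) by simp
  also have "\<dots> = (\<Sum>p\<le>d. gauss_mean n (\<lambda>x. \<Gamma> n (G p) F x * f' (F x)) / p)"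
  proof (intro sum.cong refl)
    fix p show "gauss_mean n (\<lambda>x. G p x * f (F x))
      = gauss_mean n (\<lambda>x. \<Gamma> n (G p) F x * f' (F x)) / p"
      using st(1)[of p] G_0 by (cases "p = 0") (auto simp: field_simps)
  qed
  also have "\<dots> = gauss_mean n (\<lambda>x. T x * f' (F x))"
    unfolding T using st(3) by (subst Bochner_Integration.integral_sum) auto
  finally show "gauss_mean n (\<lambda>x. F x * f (F x)) = gauss_mean n (\<lambda>x. T x * f' (F x))" .
qed

lemma real_distribution_F: "real_distribution (distr (std_gaussian n) borel F)"
  using prob_space.real_distribution_distr[OF prob_space_std_gaussian]
    measurable_poly_fun[OF poly_fun_F] by blast

lemma integrable_F: "integrable (distr (std_gaussian n) borel F) (\<lambda>x. x)"
  by (subst integrable_distr_eq) (simp_all add: measurable_poly_fun)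

text \<open>For the potential \<phi> attached to the quantile coupling, Stein's equation and
  \<open>stein_identity\<close> rewrite the difference of expectations as the mean of
  \<open>f' (F x) * (1 - T x)\<close>; the factor 3 bounds \<open>f'\<close>.\<close>

lemma W1_dist_F_le:
  "W1_dist (distr (std_gaussian n) borel F) std_normal_distribution
    \<le> ennreal (3 * (d + 1)^3 * (sqrt \<kappa> + root 4 \<kappa>))"
proof -
  have "integrable std_normal_distribution (\<lambda>x. x)"
    using integrable_std_normal_distribution_moment[of 1] by simp
  from W1_dist_le_lipschitz[OF real_distribution_F real_dist_normal_dist integrable_F this]
  obtain \<phi> where "lipschitz_fun \<phi>" and W1: "W1_dist (distr (std_gaussian n) borel F)
    std_normal_distribution
      \<le> ennreal ((\<integral>x. \<phi> x \<partial>distr (std_gaussian n) borel F) - (\<integral>x. \<phi> x \<partial>std_normal_distribution))" .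
  interpret lipschitz_fun \<phi> by fact
  obtain f f' where f: "\<And>x. (f has_real_derivative f' x) (at x)" "continuous_on UNIV f'"
    "\<And>x. \<bar>f' x\<bar> \<le> 3"
    and eq: "\<And>x. f' x - x * f x = \<phi> x - (\<integral>x. \<phi> x \<partial>std_normal_distribution)"
    by (rule stein_solution) (rule that)
  note st = stein_identity[OF f]
  interpret N: prob_space "std_gaussian n"
    by (rule prob_space_std_gaussian)
  have [measurable]: "F \<in> borel_measurable (std_gaussian n)" "T \<in> borel_measurable (std_gaussian n)"
    "f' \<in> borel_measurable borel"
    using f(2) by (auto intro: measurable_poly_fun borel_measurable_continuous_onI)
  have i1: "integrable (std_gaussian n) (\<lambda>x. f' (F x))"
    by (rule N.integrable_const_bound[of _ 3]) (use f in auto)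
  have i2: "integrable (std_gaussian n) (\<lambda>x. \<phi> (F x))"
    using integrable_lip[of "distr (std_gaussian n) borel F"] real_distribution_F integrable_F
    by (subst (asm) integrable_distr_eq) (auto simp: real_distribution_def)
  have i3: "integrable (std_gaussian n) (\<lambda>x. \<bar>T x - 1\<bar>)"
    by (intro integrable_abs integrable_poly_fun) simp
  have "(\<integral>x. \<phi> x \<partial>distr (std_gaussian n) borel F) - (\<integral>x. \<phi> x \<partial>std_normal_distribution)
    = gauss_mean n (\<lambda>x. \<phi> (F x) - (\<integral>x. \<phi> x \<partial>std_normal_distribution))"
    using i2 by (subst integral_distr) (auto simp: N.prob_space)
  also have "\<dots> = gauss_mean n (\<lambda>x. f' (F x) - F x * f (F x))"
    unfolding eq ..
  also have "\<dots> = gauss_mean n (\<lambda>x. f' (F x) - T x * f' (F x))"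
    using i1 st by simp
  also have "\<dots> \<le> gauss_mean n (\<lambda>x. 3 * \<bar>T x - 1\<bar>)"
  proof (intro integral_mono Bochner_Integration.integrable_diff i1 st(3) integrable_mult_right i3)
    fix x
    have "f' (F x) - T x * f' (F x) \<le> \<bar>f' (F x) * (1 - T x)\<bar>"
      by (simp add: algebra_simps)
    also have "\<dots> \<le> 3 * \<bar>T x - 1\<bar>"
      using f(3)[of "F x"] by (simp add: abs_mult abs_minus_commute mult_right_mono)
    finally show "f' (F x) - T x * f' (F x) \<le> 3 * \<bar>T x - 1\<bar>" .
  qed
  also have "\<dots> = 3 * gauss_mean n (\<lambda>x. \<bar>T x - 1\<bar>)"
    by simp
  also have "\<dots> \<le> 3 * ((d + 1)^3 * (sqrt \<kappa> + root 4 \<kappa>))"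
    using mean_abs_T_le by simp
  finally have "(\<integral>x. \<phi> x \<partial>distr (std_gaussian n) borel F) - (\<integral>x. \<phi> x \<partial>std_normal_distribution)
    \<le> 3 * (d + 1)^3 * (sqrt \<kappa> + root 4 \<kappa>)"
    by (simp add: mult.assoc)
  with W1 show ?thesis
    by (meson ennreal_leI order_trans)
qed

end

theorem proposition3p2:
  fixes d :: nat
  assumes "d \<ge> 1"
  shows "\<exists>C::real. C > 0 \<and> (\<forall>(n::nat) (\<alpha>::nat set \<Rightarrow> real).
    let F = multilinear_poly n d \<alpha>;
        G = hom_component n \<alpha>;
        N = std_gaussian n;
        \<kappa> = (\<integral>x. F x ^ 4 \<partial>N) - 3
    in (\<integral>x. F x \<partial>N) = 0 \<and> (\<integral>x. (F x)\<^sup>2 \<partial>N) = 1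
       \<and> (\<forall>i\<le>d. \<forall>j\<le>d. distinct [i, j] \<longrightarrow> (\<integral>x. G i x * G j x ^ 3 \<partial>N) \<ge> 0)
       \<and> (\<forall>i\<le>d. \<forall>j\<le>d. \<forall>k\<le>d. distinct [i, j, k] \<longrightarrow>
            (\<integral>x. G i x * G j x * (G k x)\<^sup>2 \<partial>N) \<ge> 0)
       \<and> (\<forall>i\<le>d. \<forall>j\<le>d. \<forall>k\<le>d. \<forall>l\<le>d. distinct [i, j, k, l] \<longrightarrow>
            (\<integral>x. G i x * G j x * G k x * G l x \<partial>N) \<ge> 0)
       \<longrightarrow>
         W1_dist (distr N borel F) std_normal_distribution
           \<le> ennreal C * (MAX m\<in>{1..d}. inverse (ennreal (\<integral>x. (G m x)\<^sup>2 \<partial>N)))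
               * ennreal (sqrt \<kappa> + root 4 \<kappa>)
       \<and> d2_dist (distr N borel F) std_normal_distribution
           \<le> ennreal (C * (sqrt \<kappa> + root 4 \<kappa>)))"
proof (intro exI[of _ "3 * (real d + 1)^3"] conjI allI)
  \<comment> \<open>In this constant, 3 bounds the derivative of the Stein solution and the cube
    comes from \<open>mean_abs_T_le\<close>.\<close>
  show "0 < 3 * (real d + 1)^3"
    by simp
next
  fix n and \<alpha> :: "nat set \<Rightarrow> real"
  let ?F = "multilinear_poly n d \<alpha>" and ?G = "hom_component n \<alpha>" and ?N = "std_gaussian n"
  let ?\<kappa> = "(\<integral>x. ?F x ^ 4 \<partial>?N) - 3" and ?C = "3 * (real d + 1)^3"
  let ?max = "MAX m\<in>{1..d}. inverse (ennreal (\<integral>x. (?G m x)\<^sup>2 \<partial>?N))"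
  have "W1_dist (distr ?N borel ?F) std_normal_distribution
    \<le> ennreal ?C * ?max * ennreal (sqrt ?\<kappa> + root 4 ?\<kappa>)
      \<and> d2_dist (distr ?N borel ?F) std_normal_distribution \<le> ennreal (?C * (sqrt ?\<kappa> + root 4 ?\<kappa>))"
    if mean: "(\<integral>x. ?F x \<partial>?N) = 0" and var: "(\<integral>x. (?F x)\<^sup>2 \<partial>?N) = 1"
      and m3: "\<forall>i\<le>d. \<forall>j\<le>d. distinct [i, j] \<longrightarrow> (\<integral>x. ?G i x * ?G j x ^ 3 \<partial>?N) \<ge> 0"
      and m2: "\<forall>i\<le>d. \<forall>j\<le>d. \<forall>k\<le>d. distinct [i, j, k] \<longrightarrow> (\<integral>x. ?G i x * ?G j x * (?G k x)\<^sup>2 \<partial>?N) \<ge> 0"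
      and m1: "\<forall>i\<le>d. \<forall>j\<le>d. \<forall>k\<le>d. \<forall>l\<le>d. distinct [i, j, k, l] \<longrightarrow>
        (\<integral>x. ?G i x * ?G j x * ?G k x * ?G l x \<partial>?N) \<ge> 0"
  proof -
    have G_poly: "poly_fun n (?G m)" for m
      using chaos_hom_component by (rule chaos_poly_fun)
    have sum_G: "(\<lambda>x. \<Sum>m\<le>d. ?G m x) = ?F"
      by (simp add: multilinear_poly_eq_sum_hom_component fun_eq_iff)
    \<comment> \<open>The component of order 0 is a constant, and it equals the mean of the
      polynomial because all other components are centred.\<close>
    obtain c where c: "?G 0 = (\<lambda>x. c)"
      using chaos_hom_component[of n 0 \<alpha>] poly_deg_0D[of n 0 "?G 0"] by (auto simp: chaos_def)
    have "0 = (\<Sum>m\<le>d. gauss_mean n (?G m))"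
      using mean G_poly unfolding sum_G[symmetric] by simp
    also have "\<dots> = (\<Sum>m\<le>d. if m = 0 then c else 0)"
      by (intro sum.cong refl) (simp add: c chaos_mean_0[OF chaos_hom_component])
    finally have "c = 0"
      by simp
    interpret nonneg_mixed_moments n d ?G
      using m1 m2 m3 c \<open>c = 0\<close> var by unfold_locales (simp_all add: chaos_hom_component flip: sum_G)
    have F: "F = ?F"
      unfolding F_def[abs_def] by (rule sum_G)
    have \<kappa>: "\<kappa> = ?\<kappa>"
      by (simp add: \<kappa>_def F)
    have W1: "W1_dist (distr ?N borel ?F) std_normal_distribution
      \<le> ennreal (?C * (sqrt ?\<kappa> + root 4 ?\<kappa>))"
      using W1_dist_F_le by (simp add: F \<kappa> add.commute)
    \<comment> \<open>One index suffices to bound the maximum below: \<open>s 1\<close> is at most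
      the total variance 1, and if it is 0 its inverse is infinite.\<close>
    have "1 \<le> inverse (ennreal (s 1))"
    proof (cases "s 1 = 0")
      case False
      then have "0 < s 1"
        using s_nonneg[of 1] by simp
      then have "ennreal 1 \<le> inverse (ennreal (s 1))"
        using s_le_1[of 1] assms unfolding inverse_ennreal[OF \<open>0 < s 1\<close>]
        by (intro ennreal_leI) (simp add: one_le_inverse)
      then show ?thesis
        by simp
    qed simp
    also have "\<dots> \<le> ?max"
      using assms by (intro Max_ge) (auto simp: s_def)
    finally have max: "1 \<le> ?max" .
    have "ennreal (?C * (sqrt ?\<kappa> + root 4 ?\<kappa>)) = ennreal ?C * 1 * ennreal (sqrt ?\<kappa> + root 4 ?\<kappa>)"
      using \<kappa>_nonneg by (simp add: ennreal_mult \<kappa>)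
    also have "\<dots> \<le> ennreal ?C * ?max * ennreal (sqrt ?\<kappa> + root 4 ?\<kappa>)"
      by (intro mult_mono max) auto
    finally have "W1_dist (distr ?N borel ?F) std_normal_distribution
      \<le> ennreal ?C * ?max * ennreal (sqrt ?\<kappa> + root 4 ?\<kappa>)"
      using W1 by (rule order_trans[rotated])
    moreover have "d2_dist (distr ?N borel ?F) std_normal_distribution
      \<le> W1_dist (distr ?N borel ?F) std_normal_distribution"
      using d2_dist_le_W1_dist[OF real_distribution_F real_dist_normal_dist integrable_F]
        integrable_std_normal_distribution_moment[of 1] by (simp add: F)
    ultimately show ?thesis
      using W1 by (auto intro: order_trans)
  qed
  then show "let F = ?F; G = ?G; N = ?N; \<kappa> = (\<integral>x. F x ^ 4 \<partial>N) - 3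
    in (\<integral>x. F x \<partial>N) = 0 \<and> (\<integral>x. (F x)\<^sup>2 \<partial>N) = 1
       \<and> (\<forall>i\<le>d. \<forall>j\<le>d. distinct [i, j] \<longrightarrow> (\<integral>x. G i x * G j x ^ 3 \<partial>N) \<ge> 0)
       \<and> (\<forall>i\<le>d. \<forall>j\<le>d. \<forall>k\<le>d. distinct [i, j, k] \<longrightarrow>
            (\<integral>x. G i x * G j x * (G k x)\<^sup>2 \<partial>N) \<ge> 0)
       \<and> (\<forall>i\<le>d. \<forall>j\<le>d. \<forall>k\<le>d. \<forall>l\<le>d. distinct [i, j, k, l] \<longrightarrow>
            (\<integral>x. G i x * G j x * G k x * G l x \<partial>N) \<ge> 0)
       \<longrightarrow>
         W1_dist (distr N borel F) std_normal_distribution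
           \<le> ennreal ?C * (MAX m\<in>{1..d}. inverse (ennreal (\<integral>x. (G m x)\<^sup>2 \<partial>N)))
               * ennreal (sqrt \<kappa> + root 4 \<kappa>)
       \<and> d2_dist (distr N borel F) std_normal_distribution
           \<le> ennreal (?C * (sqrt \<kappa> + root 4 \<kappa>))"
    unfolding Let_def by blast
qed

end
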